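(* Let $n\ge 1$. The rule $\mathrm{Cut}$ is effectively eliminable in the wellfounded sequent calculus $\mathcal{G}\mathsf{wGL}_n$: there is an effective (computable) procedure which, given any proof of a sequent $S$ in $\mathcal{G}\mathsf{wGL}_n+\mathrm{Cut}$, outputs a proof of the same sequent $S$ in $\mathcal{G}\mathsf{wGL}_n$ (without $\mathrm{Cut}$).
   Context: Formulas are built from a countably infinite set $\mathrm{Var}$ of propositional variables by $\phi::=p\mid\bot\mid\phi\to\phi\mid\Box\phi$; $\Box^0\phi:=\phi$, $\Box^{m+1}\phi:=\Box\Box^m\phi$. A sequent $\Gamma\Rightarrow\Delta$ is an ordered pair of finite multisets of formulas. For a finite multiset $\Sigma$, $\Box^n\Sigma$ is the multiset obtained by prefixing each element with $\Box^n$, and $\boxdot^n\Sigma$ denotes the multiset $\Box^n\Sigma,\Sigma$. The calculus $\mathcal{G}\mathsf{wGL}_n$ has the following rules ($p\in\mathrm{Var}$, all multisets arbitrary and finite): (ax) conclude $p,\Gamma\Rightarrow p,\Delta$ from no premises; ($\bot$L) conclude $\bot,\Gamma\Rightarrow\Delta$ from no premises; ($\bot$R) from $\Gamma\Rightarrow\Delta$ infer $\Gamma\Rightarrow\bot,\Delta$; ($\to$L) from $\Gamma\Rightarrow\phi,\Delta$ and $\psi,\Gamma\Rightarrow\Delta$ infer $\phi\to\psi,\Gamma\Rightarrow\Delta$; ($\to$R) from $\phi,\Gamma\Rightarrow\psi,\Delta$ infer $\Gamma\Rightarrow\phi\to\psi,\Delta$; ($\Box^{\mathsf{wGL}_n}$)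 from $\boxdot^n\Sigma,\Box^n\phi\Rightarrow\phi$ infer $\Box\Sigma,\Gamma\Rightarrow\Box\phi,\Delta$. $\mathcal{G}\mathsf{wGL}_n+\mathrm{Cut}$ additionally has the rule $\mathrm{Cut}$: from $\Gamma\Rightarrow\Delta,\chi$ and $\chi,\Gamma\Rightarrow\Delta$ infer $\Gamma\Rightarrow\Delta$. Proofs are finite trees of sequents, labelled with rules, locally correct with respect to the rules. *)

theory Defs
  imports "HOL-Library.Multiset" "HOL-Library.Nat_Bijection"
begin

section \<open>Formulas and sequents\<close>

datatype fm = Var nat | Bot | Imp fm fm | Box fm

type_synonym sequent = "fm multiset \<times> fm multiset"

abbreviation boxes :: "nat \<Rightarrow> fm multiset \<Rightarrow> fm multiset" where
  "boxes n \<Sigma> \<equiv> image_mset (Box ^^ n) \<Sigma>"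

abbreviation dotboxes :: "nat \<Rightarrow> fm multiset \<Rightarrow> fm multiset" where
  "dotboxes n \<Sigma> \<equiv> boxes n \<Sigma> + \<Sigma>"

section \<open>The calculus\<close>

datatype rule_name = Ax | BotL | BotR | ImpL | ImpR | BoxR | Cut

inductive rule_instance :: "nat \<Rightarrow> rule_name \<Rightarrow> sequent list \<Rightarrow> sequent \<Rightarrow> bool" for n where
  ax: "rule_instance n Ax [] (add_mset (Var p) \<Gamma>, add_mset (Var p) \<Delta>)"
| botL: "rule_instance n BotL [] (add_mset Bot \<Gamma>, \<Delta>)"
| botR: "rule_instance n BotR [(\<Gamma>, \<Delta>)] (\<Gamma>, add_mset Bot \<Delta>)"
| impL: "rule_instance n ImpL [(\<Gamma>, add_mset \<phi> \<Delta>), (add_mset \<psi> \<Gamma>, \<Delta>)] (add_mset (Imp \<phi> \<psi>) \<Gamma>, \<Delta>)"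
| impR: "rule_instance n ImpR [(add_mset \<phi> \<Gamma>, add_mset \<psi> \<Delta>)] (\<Gamma>, add_mset (Imp \<phi> \<psi>) \<Delta>)"
| boxR: "rule_instance n BoxR [(add_mset ((Box ^^ n) \<phi>) (dotboxes n \<Sigma>), {#\<phi>#})]
           (image_mset Box \<Sigma> + \<Gamma>, add_mset (Box \<phi>) \<Delta>)"
| cut: "rule_instance n Cut [(\<Gamma>, add_mset \<chi> \<Delta>), (add_mset \<chi> \<Gamma>, \<Delta>)] (\<Gamma>, \<Delta>)"

definition GwGL :: "rule_name set" where
  "GwGL = {Ax, BotL, BotR, ImpL, ImpR, BoxR}"

definition GwGL_Cut :: "rule_name set" where
  "GwGL_Cut = insert Cut GwGL"

datatype ptree = Node (root: sequent) rule_name "ptree list"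

fun locally_correct :: "nat \<Rightarrow> rule_name set \<Rightarrow> ptree \<Rightarrow> bool" where
  "locally_correct n R (Node S r Ps) \<longleftrightarrow>
     r \<in> R \<and> rule_instance n r (map root Ps) S \<and> (\<forall>P\<in>set Ps. locally_correct n R P)"

definition proof_of :: "nat \<Rightarrow> rule_name set \<Rightarrow> ptree \<Rightarrow> sequent \<Rightarrow> bool" where
  "proof_of n R P S \<longleftrightarrow> locally_correct n R P \<and> root P = S"

section \<open>Partial recursive functions\<close>

datatype recf = Zero | Succ | Proj nat | Comp recf "recf list" | PrimRec recf recf | Mu recf

text \<open>\<open>computes f xs y\<close>: the program \<open>f\<close>, started on the arguments \<open>xs\<close>, halts with output \<open>y\<close>.
  Recursion and search take place on the first argument; the step function of a
  primitive recursion receives the previous value followed by the recursion variable.\<close>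

inductive computes :: "recf \<Rightarrow> nat list \<Rightarrow> nat \<Rightarrow> bool" where
  zero: "computes Zero xs 0"
| succ: "computes Succ [x] (Suc x)"
| proj: "i < length xs \<Longrightarrow> computes (Proj i) xs (xs ! i)"
| comp: "length ys = length gs \<Longrightarrow> (\<And>i. i < length gs \<Longrightarrow> computes (gs ! i) xs (ys ! i)) \<Longrightarrow>
    computes f ys z \<Longrightarrow> computes (Comp f gs) xs z"
| primrec_0: "computes f xs y \<Longrightarrow> computes (PrimRec f g) (0 # xs) y"
| primrec_Suc: "computes (PrimRec f g) (x # xs) y \<Longrightarrow> computes g (y # x # xs) z \<Longrightarrow>
    computes (PrimRec f g) (Suc x # xs) z"
| mu: "computes f (y # xs) 0 \<Longrightarrow> (\<And>x. x < y \<Longrightarrow> \<exists>v. computes f (x # xs) (Suc v)) \<Longrightarrow>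
    computes (Mu f) xs y"

inductive_cases computes_ZeroE: "computes Zero xs y"
  and computes_SuccE: "computes Succ xs y"
  and computes_ProjE: "computes (Proj i) xs y"
  and computes_CompE: "computes (Comp f gs) xs y"
  and computes_PrimRec0E: "computes (PrimRec f g) (0 # xs) y"
  and computes_PrimRecSucE: "computes (PrimRec f g) (Suc x # xs) y"
  and computes_MuE: "computes (Mu f) xs y"

lemma computes_deterministic:
  "computes f xs y \<Longrightarrow> computes f xs z \<Longrightarrow> y = z"
proof (induction arbitrary: z rule: computes.induct)
  case (zero xs)
  then show ?case by (rule computes_ZeroE) simp
next
  case (succ x)
  then show ?case by (rule computes_SuccE) simp
next
  case (proj i xs)
  from proj.prems show ?case by (rule computes_ProjE) simp
next
  case (comp ys gs xs f w)
  from comp.prems obtain ys' where ys': "length ys' = length gs"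
    "\<And>i. i < length gs \<Longrightarrow> computes (gs ! i) xs (ys' ! i)" "computes f ys' z"
    by (rule computes_CompE) blast
  have "ys = ys'"
  proof (rule nth_equalityI)
    show "length ys = length ys'" using comp.hyps ys'(1) by simp
    fix i assume "i < length ys"
    then have "i < length gs" using comp.hyps by simp
    then show "ys ! i = ys' ! i" using comp.IH(1) ys'(2) by blast
  qed
  then show ?case using comp.IH(2) ys'(3) by blast
next
  case (primrec_0 f xs y g)
  from primrec_0.prems have "computes f xs z" by (rule computes_PrimRec0E)
  then show ?case by (rule primrec_0.IH)
next
  case (primrec_Suc f g x xs y w)
  from primrec_Suc.prems obtain y' where y': "computes (PrimRec f g) (x # xs) y'"
    "computes g (y' # x # xs) z"
    by (rule computes_PrimRecSucE)
  then have "y = y'" using primrec_Suc.IH(1) by blast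
  then show ?case using primrec_Suc.IH(2) y'(2) by blast
next
  case (mu f y xs)
  from mu.prems obtain z0: "computes f (z # xs) 0"
    and zS: "\<And>x. x < z \<Longrightarrow> \<exists>v. computes f (x # xs) (Suc v)"
    by (rule computes_MuE) blast
  show ?case
  proof (cases y z rule: linorder_cases)
    case less
    then obtain v where "computes f (y # xs) (Suc v)" using zS by blast
    then have "0 = Suc v" by (rule mu.IH(1))
    then show ?thesis by simp
  next
    case greater
    then obtain v where "\<And>w. computes f (z # xs) w \<longrightarrow> Suc v = w" using mu.IH(2) by blast
    then have "Suc v = 0" using z0 by blast
    then show ?thesis by simp
  qed
qed

section \<open>Goedel numbering of proofs\<close>

primrec fm_code :: "fm \<Rightarrow> nat" where
  "fm_code (Var p) = prod_encode (0, p)"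
| "fm_code Bot = prod_encode (1, 0)"
| "fm_code (Imp \<phi> \<psi>) = prod_encode (2, prod_encode (fm_code \<phi>, fm_code \<psi>))"
| "fm_code (Box \<phi>) = prod_encode (3, fm_code \<phi>)"

text \<open>A finite multiset is coded by the list of the codes of its elements in increasing order,
  so that the code does not depend on an enumeration of the multiset.\<close>

definition mset_code :: "fm multiset \<Rightarrow> nat" where
  "mset_code \<Gamma> = list_encode (sorted_list_of_multiset (image_mset fm_code \<Gamma>))"

definition sequent_code :: "sequent \<Rightarrow> nat" where
  "sequent_code S = prod_encode (mset_code (fst S), mset_code (snd S))"

primrec rule_code :: "rule_name \<Rightarrow> nat" where
  "rule_code Ax = 0"
| "rule_code BotL = 1"
| "rule_code BotR = 2"
| "rule_code ImpL = 3"
| "rule_code ImpR = 4"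
| "rule_code BoxR = 5"
| "rule_code Cut = 6"

primrec ptree_code :: "ptree \<Rightarrow> nat" where
  "ptree_code (Node S r Ps) =
     prod_encode (sequent_code S, prod_encode (rule_code r, list_encode (map ptree_code Ps)))"

lemma fm_code_inject: "fm_code \<phi> = fm_code \<psi> \<longleftrightarrow> \<phi> = \<psi>"
proof (induction \<phi> arbitrary: \<psi>)
  case (Var p) then show ?case by (cases \<psi>) auto
next
  case Bot then show ?case by (cases \<psi>) auto
next
  case (Imp a b) then show ?case by (cases \<psi>) auto
next
  case (Box a) then show ?case by (cases \<psi>) auto
qed

lemma mset_code_inject: "mset_code \<Gamma> = mset_code \<Delta> \<longleftrightarrow> \<Gamma> = \<Delta>"
proof
  assume "mset_code \<Gamma> = mset_code \<Delta>"
  then have "image_mset fm_code \<Gamma> = image_mset fm_code \<Delta>"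
    by (metis mset_code_def list_encode_eq mset_sorted_list_of_multiset)
  moreover have "inj fm_code" by (simp add: inj_def fm_code_inject)
  ultimately show "\<Gamma> = \<Delta>" by (metis multiset.inj_map injD)
qed simp

lemma sequent_code_inject: "sequent_code S = sequent_code T \<longleftrightarrow> S = T"
  by (simp add: sequent_code_def mset_code_inject prod_eq_iff)

lemma rule_code_inject: "rule_code r = rule_code s \<longleftrightarrow> r = s"
  by (cases r; cases s) auto

lemma ptree_code_inject: "ptree_code P = ptree_code Q \<longleftrightarrow> P = Q"
proof (induction P arbitrary: Q)
  case (Node S r Ps)
  obtain T s Qs where Q: "Q = Node T s Qs" by (cases Q)
  have "map ptree_code Ps = map ptree_code Qs \<longleftrightarrow> Ps = Qs"
  proof
    assume eq: "map ptree_code Ps = map ptree_code Qs"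
    then have len: "length Ps = length Qs" by (metis length_map)
    show "Ps = Qs"
      using len
    proof (rule nth_equalityI)
      fix i assume "i < length Ps"
      then show "Ps ! i = Qs ! i"
        using eq len Node.IH[of "Ps ! i" "Qs ! i"] by (metis nth_map nth_mem)
    qed
  qed simp
  then show ?case
    by (simp add: Q sequent_code_inject rule_code_inject list_encode_eq)
qed

end

theory Submission
  imports Defs
begin

text \<open>
  The proof has two independent halves: a cut-free proof of the sequent exists, and it can be found
  by unbounded search.

  Existence is shown semantically. The logic is that of the Kripke frames whose accessibility
  relation is conversely wellfounded and contains its own \<open>(n+1)\<close>-fold composition
  (\<open>wGL_frame\<close>). All rules, Cut included, preserve validity on such frames (\<open>sound\<close>), so it suffices
  that the cut-free calculus is complete (\<open>complete\<close>). For a sequent without a cut-free proof, the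
  worlds of a countermodel are Hintikka pairs obtained by saturating unprovable sequents
  (\<open>saturate\<close>), and one step of the rule for \<open>Box\<close>, read backwards, leads from a world refuting
  \<open>Box \<phi>\<close> to a world refuting \<open>\<phi>\<close> (\<open>step_exists\<close>). Accessibility is defined as \<open>1 + k n\<close> steps for
  some \<open>k\<close>, which makes \<open>(n+1)\<close>-fold compositions harmless by construction. It respects boxes
  because \<open>Box \<sigma>\<close> on the left of a world puts \<open>Box\<^sup>n \<sigma>\<close> on the left of its successor, and the next
  \<open>n - 1\<close> steps strip this down to \<open>Box \<sigma>\<close> again (\<open>step_pow_period\<close>).

  For \<open>n > 1\<close> the formulas on the left do not stay within a finite set, since prefixes of boxes may
  grow. Wellfoundedness (\<open>step_wf\<close>) therefore rests on the right-hand sides only: these stay among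
  the subformulas of the refuted sequent. On an infinite chain of steps some principal formula
  \<open>Box \<phi>\<close> recurs at two positions that are congruent modulo \<open>n\<close>. The first occurrence put the diagonal
  formula \<open>Box\<^sup>n \<phi>\<close> on the left, which produces \<open>Box \<phi>\<close> on the left after every positive multiple of
  \<open>n\<close> steps, hence on both sides of the second position; but such a sequent is provable.

  For the search, \<open>nth_proof n\<close> reads every natural number as a recipe for a proof, in such a
  way that all of its values are correct cut-free proofs and all cut-free proofs are values
  (\<open>nth_proof_correct\<close>, \<open>nth_proof_complete\<close>). Hence no proof checker has to be programmed: the
  procedure looks for the first \<open>t\<close> such that \<open>nth_proof n t\<close> has the same end sequent as the given
  proof. What remains is that the code of \<open>nth_proof n t\<close> is a computable function of \<open>t\<close>
  (\<open>computable_nth_proof\<close>), which follows from closure of the computable functions under pairing,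
  definition by cases and course-of-values recursion.
\<close>

section \<open>Kripke semantics and soundness\<close>

primrec sat :: "('w \<Rightarrow> 'w \<Rightarrow> bool) \<Rightarrow> ('w \<Rightarrow> nat \<Rightarrow> bool) \<Rightarrow> 'w \<Rightarrow> fm \<Rightarrow> bool" where
  "sat R V w (Var p) \<longleftrightarrow> V w p"
| "sat R V w Bot \<longleftrightarrow> False"
| "sat R V w (Imp \<phi> \<psi>) \<longleftrightarrow> (sat R V w \<phi> \<longrightarrow> sat R V w \<psi>)"
| "sat R V w (Box \<phi>) \<longleftrightarrow> (\<forall>v. R w v \<longrightarrow> sat R V v \<phi>)"

definition holds :: "('w \<Rightarrow> 'w \<Rightarrow> bool) \<Rightarrow> ('w \<Rightarrow> nat \<Rightarrow> bool) \<Rightarrow> sequent \<Rightarrow> bool" where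
  "holds R V S \<longleftrightarrow>
     (\<forall>w. (\<forall>\<phi>\<in>#fst S. sat R V w \<phi>) \<longrightarrow> (\<exists>\<psi>\<in>#snd S. sat R V w \<psi>))"

definition wGL_frame :: "nat \<Rightarrow> ('w \<Rightarrow> 'w \<Rightarrow> bool) \<Rightarrow> bool" where
  "wGL_frame n R \<longleftrightarrow> wfp R\<inverse>\<inverse> \<and> (\<forall>u w. (R ^^ Suc n) u w \<longrightarrow> R u w)"

lemma sat_Box_pow: "sat R V w ((Box ^^ k) \<phi>) \<longleftrightarrow> (\<forall>v. (R ^^ k) w v \<longrightarrow> sat R V v \<phi>)"
proof (induction k arbitrary: w)
  case 0
  then show ?case by simp
next
  case (Suc k)
  have "(R ^^ Suc k) w v \<longleftrightarrow> (\<exists>u. R w u \<and> (R ^^ k) u v)" for v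
    by (metis relpowp_Suc_D2 relpowp_Suc_I2)
  then show ?case using Suc.IH by auto
qed

text \<open>Loeb's argument. Induction along the converse of the transitive closure of \<open>R\<close> shows that \<open>\<phi>\<close> holds at
  all successors \<open>v\<close> of \<open>w\<close>: whatever is \<open>n\<close> steps above \<open>v\<close> is \<open>n + 1\<close> steps above \<open>w\<close> and thus again a
  successor of \<open>w\<close>, so the induction hypothesis gives the diagonal formula at \<open>v\<close>. The condition
  \<open>n \<ge> 1\<close> ensures that the induction descends.\<close>
lemma BoxR_sound:
  assumes n: "n \<ge> 1" and frame: "wGL_frame n R"
    and prem: "holds R V (add_mset ((Box ^^ n) \<phi>) (dotboxes n \<Sigma>), {#\<phi>#})"
    and \<Sigma>: "\<And>\<sigma>. \<sigma> \<in># \<Sigma> \<Longrightarrow> sat R V w (Box \<sigma>)"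
  shows "sat R V w (Box \<phi>)"
proof -
  have trans: "R u v" if "R u x" "(R ^^ n) x v" for u x v
    using frame that relpowp_Suc_I2 unfolding wGL_frame_def by metis
  have wf: "wfp (R\<inverse>\<inverse>\<^sup>+\<^sup>+)"
    using frame unfolding wGL_frame_def by (simp add: wfp_tranclp)
  have "R w v \<longrightarrow> sat R V v \<phi>" for v
    using wf
  proof (induction v rule: wfp_induct_rule)
    case (less v)
    show ?case
    proof
      assume wv: "R w v"
      have "sat R V v ((Box ^^ n) \<phi>)"
        unfolding sat_Box_pow
      proof (intro allI impI)
        fix u assume vu: "(R ^^ n) v u"
        then have "R\<^sup>+\<^sup>+ v u" using n by (metis tranclp_power less_eq_Suc_le One_nat_def)
        then have "R\<inverse>\<inverse>\<^sup>+\<^sup>+ u v" by (simp add: tranclp_converse)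
        then show "sat R V u \<phi>" using less trans[OF wv vu] by blast
      qed
      moreover have "sat R V v \<sigma>" "sat R V v ((Box ^^ n) \<sigma>)" if "\<sigma> \<in># \<Sigma>" for \<sigma>
        using \<Sigma>[OF that] wv trans[OF wv] by (auto simp: sat_Box_pow)
      ultimately show "sat R V v \<phi>" using prem unfolding holds_def by auto
    qed
  qed
  then show ?thesis by simp
qed

lemma rule_sound:
  assumes "n \<ge> 1" and "wGL_frame n R"
    and "rule_instance n r Ss S" and "\<forall>T\<in>set Ss. holds R V T"
  shows "holds R V S"
  using assms(3,4)
proof cases
  case (boxR \<phi> \<Sigma> \<Gamma> \<Delta>)
  then have prem: "holds R V (add_mset ((Box ^^ n) \<phi>) (dotboxes n \<Sigma>), {#\<phi>#})"
    using assms(4) by simp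
  show ?thesis
    unfolding holds_def
  proof (intro allI impI)
    fix w assume "\<forall>\<chi>\<in>#fst S. sat R V w \<chi>"
    then have "sat R V w (Box \<sigma>)" if "\<sigma> \<in># \<Sigma>" for \<sigma>
      using boxR that by (auto simp del: sat.simps)
    then have "sat R V w (Box \<phi>)" using BoxR_sound[OF assms(1,2) prem] by blast
    then show "\<exists>\<psi>\<in>#snd S. sat R V w \<psi>" using boxR by auto
  qed
qed (auto simp: holds_def)

lemma sound:
  assumes "n \<ge> 1" and "wGL_frame n R"
  shows "locally_correct n Rs P \<Longrightarrow> holds R V (root P)"
proof (induction P)
  case (Node S r Ps)
  then show ?case using rule_sound[OF assms, of r "map root Ps" S] by auto
qed

section \<open>Worlds from unprovable sequents\<close>

definition provable :: "nat \<Rightarrow> sequent \<Rightarrow> bool" where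
  "provable n S \<longleftrightarrow> (\<exists>P. proof_of n GwGL P S)"

lemma provable_rule:
  assumes "rule_instance n r Ss S" and "r \<noteq> Cut" and "\<forall>T\<in>set Ss. provable n T"
  shows "provable n S"
proof -
  obtain pf where pf: "\<And>T. T \<in> set Ss \<Longrightarrow> proof_of n GwGL (pf T) T"
    using assms(3) unfolding provable_def by metis
  have "map root (map pf Ss) = Ss" by (rule nth_equalityI) (use pf in \<open>auto simp: proof_of_def\<close>)
  moreover have "r \<in> GwGL" using assms(2) by (cases r) (auto simp: GwGL_def)
  ultimately have "proof_of n GwGL (Node S r (map pf Ss)) S"
    using assms(1) pf by (auto simp: proof_of_def)
  then show ?thesis unfolding provable_def by blast
qed

lemmas provable_rules =
  provable_rule[OF ax, simplified] provable_rule[OF botL, simplified]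
  provable_rule[OF botR, simplified] provable_rule[OF impL, simplified]
  provable_rule[OF impR, simplified] provable_rule[OF boxR, simplified]

lemma provable_id: "provable n (add_mset \<phi> \<Gamma>, add_mset \<phi> \<Delta>)"
proof (induction \<phi> arbitrary: \<Gamma> \<Delta>)
  case (Imp \<phi> \<psi>)
  have "provable n (add_mset (Imp \<phi> \<psi>) (add_mset \<phi> \<Gamma>), add_mset \<psi> \<Delta>)"
    using Imp.IH(1)[of \<Gamma> "add_mset \<psi> \<Delta>"] Imp.IH(2)[of "add_mset \<phi> \<Gamma>" \<Delta>]
    by (intro provable_rules) (simp_all add: add_mset_commute)
  then show ?case by (intro provable_rules) (simp add: add_mset_commute)
next
  case (Box \<phi>)
  have "provable n (add_mset ((Box ^^ n) \<phi>) (dotboxes n {#\<phi>#}), {#\<phi>#})"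
    using Box.IH[of "{#(Box ^^ n) \<phi>, (Box ^^ n) \<phi>#}" "{#}"] by (simp add: add_mset_commute)
  then have "provable n (image_mset Box {#\<phi>#} + \<Gamma>, add_mset (Box \<phi>) \<Delta>)"
    by (intro provable_rule[OF boxR]) auto
  then show ?case by simp
qed (intro provable_rules)+

primrec subfms :: "fm \<Rightarrow> fm set" where
  "subfms (Var p) = {Var p}"
| "subfms Bot = {Bot}"
| "subfms (Imp \<phi> \<psi>) = insert (Imp \<phi> \<psi>) (subfms \<phi> \<union> subfms \<psi>)"
| "subfms (Box \<phi>) = insert (Box \<phi>) (subfms \<phi>)"

lemma finite_subfms: "finite (subfms \<phi>)"
  by (induction \<phi>) auto

lemma subfms_refl: "\<phi> \<in> subfms \<phi>"
  by (cases \<phi>) auto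

definition subfm_closed :: "fm set \<Rightarrow> bool" where
  "subfm_closed F \<longleftrightarrow> (\<forall>\<phi>\<in>F. subfms \<phi> \<subseteq> F)"

lemma subfms_trans: "\<psi> \<in> subfms \<phi> \<Longrightarrow> subfms \<psi> \<subseteq> subfms \<phi>"
  by (induction \<phi>) auto

lemma subfm_closedD:
  assumes "subfm_closed F"
  shows "Imp \<phi> \<psi> \<in> F \<Longrightarrow> \<phi> \<in> F" "Imp \<phi> \<psi> \<in> F \<Longrightarrow> \<psi> \<in> F" "Box \<phi> \<in> F \<Longrightarrow> \<phi> \<in> F"
proof -
  have *: "subfms \<chi> \<subseteq> F" if "\<chi> \<in> F" for \<chi>
    using assms that unfolding subfm_closed_def by blast
  show "Imp \<phi> \<psi> \<in> F \<Longrightarrow> \<phi> \<in> F" "Imp \<phi> \<psi> \<in> F \<Longrightarrow> \<psi> \<in> F" "Box \<phi> \<in> F \<Longrightarrow> \<phi> \<in> F"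
    using *[of "Imp \<phi> \<psi>"] *[of "Box \<phi>"] subfms_refl[of \<phi>] subfms_refl[of \<psi>] by auto
qed

text \<open>Passing through the rule for \<open>Box\<close> upwards prefixes left-hand formulas with boxes. Up to such
  prefixes they remain subformulas; right-hand formulas remain subformulas without a prefix.\<close>
definition box_closure :: "fm set \<Rightarrow> fm set" where
  "box_closure F = {(Box ^^ k) \<phi> | k \<phi>. \<phi> \<in> F}"

lemma box_closure_base: "\<phi> \<in> F \<Longrightarrow> \<phi> \<in> box_closure F"
  unfolding box_closure_def by (intro CollectI exI[of _ 0] exI[of _ \<phi>]) simp

lemma box_closure_pow:
  assumes "\<phi> \<in> box_closure F" shows "(Box ^^ m) \<phi> \<in> box_closure F"
proof -
  obtain k \<psi> where "\<phi> = (Box ^^ k) \<psi>" "\<psi> \<in> F" using assms unfolding box_closure_def by blast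
  then have "(Box ^^ m) \<phi> = (Box ^^ (m + k)) \<psi>" by (simp add: funpow_add)
  then show ?thesis using \<open>\<psi> \<in> F\<close> unfolding box_closure_def by blast
qed

lemma box_closure_Imp: "Imp \<phi> \<psi> \<in> box_closure F \<Longrightarrow> Imp \<phi> \<psi> \<in> F"
proof -
  assume "Imp \<phi> \<psi> \<in> box_closure F"
  then obtain k \<chi> where "Imp \<phi> \<psi> = (Box ^^ k) \<chi>" "\<chi> \<in> F" unfolding box_closure_def by blast
  then show ?thesis by (cases k) auto
qed

lemma box_closure_Box:
  assumes "subfm_closed F" and "Box \<phi> \<in> box_closure F" shows "\<phi> \<in> box_closure F"
proof -
  obtain k \<chi> where "Box \<phi> = (Box ^^ k) \<chi>" "\<chi> \<in> F"
    using assms(2) unfolding box_closure_def by blast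
  then show ?thesis
    using subfm_closedD(3)[OF assms(1), of \<phi>] box_closure_base[of \<phi> F]
    by (cases k) (auto simp: box_closure_def)
qed

type_synonym world = "fm set \<times> fm set"

definition hintikka :: "fm set \<Rightarrow> fm set \<Rightarrow> bool" where
  "hintikka A B \<longleftrightarrow> Bot \<notin> A \<and> (\<forall>p. \<not> (Var p \<in> A \<and> Var p \<in> B))
     \<and> (\<forall>\<phi> \<psi>. Imp \<phi> \<psi> \<in> A \<longrightarrow> \<phi> \<in> B \<or> \<psi> \<in> A)
     \<and> (\<forall>\<phi> \<psi>. Imp \<phi> \<psi> \<in> B \<longrightarrow> \<phi> \<in> A \<and> \<psi> \<in> B)"

text \<open>A world is a pair of sets closed under decomposition, so it contains compound formulas along with
  their parts. For the rule for \<open>Box\<close> only its boxed formulas matter, and these are kept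
  together in one unprovable sequent. Remembering a sequent in this way avoids the need for
  contraction: the sets may mention a formula after the sequent has lost it.\<close>
definition box_core :: "nat \<Rightarrow> fm set \<Rightarrow> fm set \<Rightarrow> bool" where
  "box_core n A B \<longleftrightarrow> (\<exists>\<Gamma> \<Delta>. \<not> provable n (\<Gamma>, \<Delta>) \<and> set_mset \<Gamma> \<subseteq> A
     \<and> (\<forall>\<phi>. Box \<phi> \<in> A \<longrightarrow> Box \<phi> \<in># \<Gamma>) \<and> (\<forall>\<phi>. Box \<phi> \<in> B \<longrightarrow> Box \<phi> \<in># \<Delta>))"

definition is_world :: "nat \<Rightarrow> fm set \<Rightarrow> world \<Rightarrow> bool" where
  "is_world n F w \<longleftrightarrow> hintikka (fst w) (snd w) \<and> box_core n (fst w) (snd w)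
     \<and> fst w \<subseteq> box_closure F \<and> snd w \<subseteq> F"

text \<open>The factor 2 makes the weight drop in the right rule for implication, where both parts of one
  formula remain in a single premise.\<close>
definition weight :: "fm multiset \<Rightarrow> nat" where
  "weight \<Gamma> = (\<Sum>\<phi>\<in>#\<Gamma>. Suc (2 * size \<phi>))"

lemma weight_add [simp]: "weight (add_mset \<phi> \<Gamma>) = Suc (2 * size \<phi>) + weight \<Gamma>"
  by (simp add: weight_def)

lemma box_core_extend:
  assumes "box_core n A B" and "A \<subseteq> A'" "\<And>\<phi>. Box \<phi> \<in> A' \<Longrightarrow> Box \<phi> \<in> A"
    and "\<And>\<phi>. Box \<phi> \<in> B' \<Longrightarrow> Box \<phi> \<in> B"
  shows "box_core n A' B'"
proof -
  obtain \<Gamma> \<Delta> where "\<not> provable n (\<Gamma>, \<Delta>)" "set_mset \<Gamma> \<subseteq> A"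
      "\<And>\<phi>. Box \<phi> \<in> A \<Longrightarrow> Box \<phi> \<in># \<Gamma>" "\<And>\<phi>. Box \<phi> \<in> B \<Longrightarrow> Box \<phi> \<in># \<Delta>"
    using assms(1) unfolding box_core_def by blast
  then show ?thesis
    unfolding box_core_def using assms(2-4) by (intro exI[of _ \<Gamma>] exI[of _ \<Delta>]) blast
qed

lemma world_extend_left:
  assumes "is_world n F (A, B)" and "\<phi> \<in> B \<or> \<psi> \<in> A" and "Imp \<phi> \<psi> \<in> box_closure F"
  shows "is_world n F (insert (Imp \<phi> \<psi>) A, B)"
proof -
  have "box_core n (insert (Imp \<phi> \<psi>) A) B"
    by (rule box_core_extend[of n A B]) (use assms(1) in \<open>auto simp: is_world_def\<close>)
  then show ?thesis using assms unfolding is_world_def hintikka_def by simp blast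
qed

lemma world_extend_right:
  assumes "is_world n F (A, B)" and "\<phi> \<in> A" "\<psi> \<in> B" and "Imp \<phi> \<psi> \<in> F"
  shows "is_world n F (A, insert (Imp \<phi> \<psi>) B)"
proof -
  have "box_core n A (insert (Imp \<phi> \<psi>) B)"
    by (rule box_core_extend[of n A B]) (use assms(1) in \<open>auto simp: is_world_def\<close>)
  then show ?thesis using assms unfolding is_world_def hintikka_def by simp
qed

lemma world_extend_Bot:
  assumes "is_world n F (A, B)" and "Bot \<in> F"
  shows "is_world n F (A, insert Bot B)"
proof -
  have "box_core n A (insert Bot B)"
    by (rule box_core_extend[of n A B]) (use assms(1) in \<open>auto simp: is_world_def\<close>)
  then show ?thesis using assms unfolding is_world_def hintikka_def by simp
qed

text \<open>Each rule except that for \<open>Box\<close> is applied upwards to an unprovable sequent; some premise is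
  again unprovable, and a world for it becomes one for the conclusion by adding the principal formula.\<close>
lemma saturate:
  assumes F: "subfm_closed F"
  shows "\<not> provable n (\<Gamma>, \<Delta>) \<Longrightarrow> set_mset \<Gamma> \<subseteq> box_closure F \<Longrightarrow> set_mset \<Delta> \<subseteq> F \<Longrightarrow>
    \<exists>A B. is_world n F (A, B) \<and> set_mset \<Gamma> \<subseteq> A \<and> set_mset \<Delta> \<subseteq> B"
proof (induction "weight \<Gamma> + weight \<Delta>" arbitrary: \<Gamma> \<Delta> rule: less_induct)
  case less
  note IH = less.hyps and unp = less.prems(1) and \<Gamma>F = less.prems(2) and \<Delta>F = less.prems(3)
  consider (L) \<phi> \<psi> where "Imp \<phi> \<psi> \<in># \<Gamma>" | (R) \<phi> \<psi> where "Imp \<phi> \<psi> \<in># \<Delta>"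
    | (B) "Bot \<in># \<Delta>"
    | (none) "\<And>\<phi> \<psi>. Imp \<phi> \<psi> \<notin># \<Gamma>" "\<And>\<phi> \<psi>. Imp \<phi> \<psi> \<notin># \<Delta>" "Bot \<notin># \<Delta>"
    by blast
  then show ?case
  proof cases
    case L
    then obtain \<Gamma>' where L: "\<Gamma> = add_mset (Imp \<phi> \<psi>) \<Gamma>'" by (blast dest: multi_member_split)
    have i: "Imp \<phi> \<psi> \<in> F" using \<Gamma>F L box_closure_Imp by auto
    then have sub: "\<phi> \<in> F" "\<psi> \<in> box_closure F" 
      using subfm_closedD(1,2)[OF F i] by (auto intro: box_closure_base)
    from unp L have "\<not> provable n (\<Gamma>', add_mset \<phi> \<Delta>) \<or> \<not> provable n (add_mset \<psi> \<Gamma>', \<Delta>)"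
      using provable_rules(4) by blast
    then have "\<exists>A B. is_world n F (A, B) \<and> set_mset \<Gamma>' \<subseteq> A \<and> set_mset \<Delta> \<subseteq> B \<and> (\<phi> \<in> B \<or> \<psi> \<in> A)"
    proof
      assume "\<not> provable n (\<Gamma>', add_mset \<phi> \<Delta>)"
      from IH[OF _ this] show ?thesis using L sub \<Gamma>F \<Delta>F by fastforce
    next
      assume "\<not> provable n (add_mset \<psi> \<Gamma>', \<Delta>)"
      from IH[OF _ this] show ?thesis using L sub \<Gamma>F \<Delta>F by fastforce
    qed
    then obtain A B where "is_world n F (A, B)" "set_mset \<Gamma>' \<subseteq> A" "set_mset \<Delta> \<subseteq> B" "\<phi> \<in> B \<or> \<psi> \<in> A"
      by blast
    then have "is_world n F (insert (Imp \<phi> \<psi>) A, B) \<and> set_mset \<Gamma> \<subseteq> insert (Imp \<phi> \<psi>) A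
        \<and> set_mset \<Delta> \<subseteq> B"
      using world_extend_left L \<Gamma>F by auto
    then show ?thesis by blast
  next
    case R
    then obtain \<Delta>' where R: "\<Delta> = add_mset (Imp \<phi> \<psi>) \<Delta>'" by (blast dest: multi_member_split)
    have i: "Imp \<phi> \<psi> \<in> F" using \<Delta>F R by auto
    then have sub: "\<phi> \<in> box_closure F" "\<psi> \<in> F" 
      using subfm_closedD(1,2)[OF F i] by (auto intro: box_closure_base)
    have "\<not> provable n (add_mset \<phi> \<Gamma>, add_mset \<psi> \<Delta>')"
      using unp R provable_rules(5) by blast
    from IH[OF _ this] have "\<exists>A B. is_world n F (A, B)
        \<and> set_mset (add_mset \<phi> \<Gamma>) \<subseteq> A \<and> set_mset (add_mset \<psi> \<Delta>') \<subseteq> B"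
      using R sub \<Gamma>F \<Delta>F by simp
    then obtain A B where AB: "is_world n F (A, B)"
        "set_mset (add_mset \<phi> \<Gamma>) \<subseteq> A" "set_mset (add_mset \<psi> \<Delta>') \<subseteq> B"
      by blast
    then have "is_world n F (A, insert (Imp \<phi> \<psi>) B)" using world_extend_right i by auto
    then show ?thesis using AB R by (intro exI[of _ A] exI[of _ "insert (Imp \<phi> \<psi>) B"]) auto
  next
    case B
    then obtain \<Delta>' where B: "\<Delta> = add_mset Bot \<Delta>'" by (blast dest: multi_member_split)
    have "\<not> provable n (\<Gamma>, \<Delta>')" using unp B provable_rules(3) by blast
    from IH[OF _ this] obtain A B' where AB: "is_world n F (A, B')"
        "set_mset \<Gamma> \<subseteq> A" "set_mset \<Delta>' \<subseteq> B'"
      using B \<Gamma>F \<Delta>F by auto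
    then have "is_world n F (A, insert Bot B')" using world_extend_Bot B \<Delta>F by auto
    then show ?thesis using AB B by (intro exI[of _ A] exI[of _ "insert Bot B'"]) auto
  next
    case none
    have "Bot \<notin># \<Gamma>" using unp provable_rules(2) by (metis multi_member_split)
    moreover have "\<not> (Var p \<in># \<Gamma> \<and> Var p \<in># \<Delta>)" for p
      using unp provable_rules(1) by (metis multi_member_split)
    ultimately have "hintikka (set_mset \<Gamma>) (set_mset \<Delta>)"
      using none unfolding hintikka_def by blast
    moreover have "box_core n (set_mset \<Gamma>) (set_mset \<Delta>)"
      using unp unfolding box_core_def by blast
    ultimately show ?thesis using \<Gamma>F \<Delta>F unfolding is_world_def by fastforce
  qed
qed

lemma world_Box_disjoint:
  assumes "is_world n F w" "Box \<phi> \<in> fst w" shows "Box \<phi> \<notin> snd w"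
  using assms provable_id unfolding is_world_def box_core_def by (metis multi_member_split)

section \<open>The countermodel\<close>

text \<open>What a backward application of the rule for \<open>Box\<close> followed by saturation guarantees.
  The diagonal formula is recorded because wellfoundedness depends on it.\<close>
definition step :: "nat \<Rightarrow> fm set \<Rightarrow> world \<Rightarrow> world \<Rightarrow> bool" where
  "step n F w v \<longleftrightarrow> is_world n F w \<and> is_world n F v
     \<and> (\<exists>\<phi>. Box \<phi> \<in> snd w \<and> (Box ^^ n) \<phi> \<in> fst v \<and> \<phi> \<in> snd v)
     \<and> (\<forall>\<sigma>. Box \<sigma> \<in> fst w \<longrightarrow> \<sigma> \<in> fst v \<and> (Box ^^ n) \<sigma> \<in> fst v)"

lemma split_boxes: "\<exists>\<Sigma> \<Gamma>'. \<Gamma> = image_mset Box \<Sigma> + \<Gamma>' \<and> (\<forall>\<phi>. Box \<phi> \<notin># \<Gamma>')"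
proof (induction \<Gamma>)
  case empty
  then show ?case by auto
next
  case (add \<chi> \<Gamma>)
  then obtain \<Sigma> \<Gamma>' where *: "\<Gamma> = image_mset Box \<Sigma> + \<Gamma>'" "\<forall>\<phi>. Box \<phi> \<notin># \<Gamma>'" by blast
  show ?case
  proof (cases "\<exists>\<phi>. \<chi> = Box \<phi>")
    case True
    then obtain \<phi> where "\<chi> = Box \<phi>" by blast
    then have "add_mset \<chi> \<Gamma> = image_mset Box (add_mset \<phi> \<Sigma>) + \<Gamma>'" using * by simp
    then show ?thesis using *(2) by blast
  next
    case False
    then have "add_mset \<chi> \<Gamma> = image_mset Box \<Sigma> + add_mset \<chi> \<Gamma>' \<and> (\<forall>\<phi>. Box \<phi> \<notin># add_mset \<chi> \<Gamma>')"
      using * by auto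
    then show ?thesis by blast
  qed
qed

lemma step_exists:
  assumes F: "subfm_closed F" and w: "is_world n F w" and \<phi>: "Box \<phi> \<in> snd w"
  shows "\<exists>v. step n F w v \<and> \<phi> \<in> snd v"
proof -
  obtain \<Gamma> \<Delta> where core: "\<not> provable n (\<Gamma>, \<Delta>)" "set_mset \<Gamma> \<subseteq> fst w"
      "\<And>\<phi>. Box \<phi> \<in> fst w \<Longrightarrow> Box \<phi> \<in># \<Gamma>" "\<And>\<phi>. Box \<phi> \<in> snd w \<Longrightarrow> Box \<phi> \<in># \<Delta>"
    using w unfolding is_world_def box_core_def by blast
  obtain \<Sigma> \<Gamma>' where \<Sigma>: "\<Gamma> = image_mset Box \<Sigma> + \<Gamma>'" "\<And>\<phi>. Box \<phi> \<notin># \<Gamma>'"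
    using split_boxes by metis
  obtain \<Delta>' where \<Delta>': "\<Delta> = add_mset (Box \<phi>) \<Delta>'" using core(4)[OF \<phi>] by (metis multi_member_split)
  have unp: "\<not> provable n (add_mset ((Box ^^ n) \<phi>) (dotboxes n \<Sigma>), {#\<phi>#})"
    using core(1) provable_rules(6) unfolding \<Sigma>(1) \<Delta>' by (metis union_commute)
  have \<phi>F: "\<phi> \<in> F" using w \<phi> subfm_closedD(3)[OF F] unfolding is_world_def by blast
  have "\<sigma> \<in> box_closure F" if "\<sigma> \<in># \<Sigma>" for \<sigma>
  proof (rule box_closure_Box[OF F])
    have "Box \<sigma> \<in># \<Gamma>" using that \<Sigma>(1) by auto
    then show "Box \<sigma> \<in> box_closure F" using w core(2) unfolding is_world_def by blast
  qed
  then have "set_mset (add_mset ((Box ^^ n) \<phi>) (dotboxes n \<Sigma>)) \<subseteq> box_closure F"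
    using \<phi>F by (auto intro: box_closure_pow box_closure_base)
  from saturate[OF F unp this] obtain A B where AB: "is_world n F (A, B)"
      "set_mset (add_mset ((Box ^^ n) \<phi>) (dotboxes n \<Sigma>)) \<subseteq> A" "\<phi> \<in> B"
    using \<phi>F by auto
  have "\<sigma> \<in># \<Sigma>" if "Box \<sigma> \<in> fst w" for \<sigma>
    using core(3)[OF that] \<Sigma> by auto
  then have "step n F w (A, B)" using w AB \<phi> unfolding step_def by auto
  then show ?thesis using AB(3) by auto
qed

lemma step_pow_strip:
  "(step n F ^^ d) w v \<Longrightarrow> (Box ^^ (d + a)) \<phi> \<in> fst w \<Longrightarrow> (Box ^^ a) \<phi> \<in> fst v"
proof (induction d arbitrary: w)
  case 0
  then show ?case by simp
next
  case (Suc d)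
  obtain u where u: "step n F w u" "(step n F ^^ d) u v" using Suc.prems(1) by (metis relpowp_Suc_D2)
  then have "(Box ^^ (d + a)) \<phi> \<in> fst u" using Suc.prems(2) unfolding step_def by simp
  then show ?case using Suc.IH[OF u(2)] by blast
qed

text \<open>The successor receives \<open>Box\<^sup>n \<phi>\<close>, of which the remaining \<open>n - 1\<close> steps leave \<open>Box \<phi>\<close>.\<close>
lemma step_pow_diag:
  assumes "n \<ge> 1" "(step n F ^^ n) w v" "\<And>u. step n F w u \<Longrightarrow> (Box ^^ n) \<phi> \<in> fst u"
  shows "Box \<phi> \<in> fst v"
proof -
  obtain m where m: "n = Suc m" using assms(1) by (cases n) auto
  obtain u where u: "step n F w u" "(step n F ^^ m) u v"
    using assms(2) unfolding m by (metis relpowp_Suc_D2)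
  have "(Box ^^ (m + 1)) \<phi> \<in> fst u" using assms(3)[OF u(1)] unfolding m by simp
  from step_pow_strip[OF u(2) this] show ?thesis by simp
qed

lemma step_pow_period:
  assumes n: "n \<ge> 1"
  shows "(step n F ^^ (k * n)) w v \<Longrightarrow> Box \<phi> \<in> fst w \<Longrightarrow> Box \<phi> \<in> fst v"
proof (induction k arbitrary: w)
  case 0
  then show ?case by simp
next
  case (Suc k)
  obtain u where u: "(step n F ^^ n) w u" "(step n F ^^ (k * n)) u v"
    using Suc.prems(1) unfolding mult_Suc relpowp_add by blast
  have "Box \<phi> \<in> fst u"
    by (rule step_pow_diag[OF n u(1)]) (use Suc.prems(2) in \<open>simp add: step_def\<close>)
  then show ?case using Suc.IH u(2) by blast
qed

lemma chain_pow: "(\<And>i. r (s i) (s (Suc i))) \<Longrightarrow> (r ^^ d) (s i) (s (i + d))"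
  by (induction d) auto

text \<open>Pigeonhole on the pairs of the principal formula and the position modulo \<open>n\<close>. Finiteness of \<open>F\<close>
  bounds the right-hand sides only; the left-hand sides may keep growing within \<open>box_closure F\<close>.\<close>
lemma step_wf:
  assumes n: "n \<ge> 1" and F: "finite F"
  shows "wfp (step n F)\<inverse>\<inverse>"
proof (rule ccontr)
  assume "\<not> ?thesis"
  then obtain s where s: "\<And>i. step n F (s i) (s (Suc i))"
    unfolding wfp_def wf_iff_no_infinite_down_chain by auto
  define principal where "principal i \<phi> \<longleftrightarrow> Box \<phi> \<in> snd (s i) \<and> (Box ^^ n) \<phi> \<in> fst (s (Suc i))" for i \<phi>
  have "\<forall>i. \<exists>\<phi>. principal i \<phi>" using s unfolding principal_def step_def by blast
  then obtain \<phi> where \<phi>: "\<And>i. principal i (\<phi> i)" by metis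
  have "Box (\<phi> i) \<in> F" for i using \<phi> s unfolding principal_def step_def is_world_def by blast
  then have "range (\<lambda>i. (Box (\<phi> i), i mod n)) \<subseteq> F \<times> {..<n}" using n by auto
  then have "finite (range (\<lambda>i. (Box (\<phi> i), i mod n)))"
    using F finite_subset by blast
  then have "\<not> inj (\<lambda>i. (Box (\<phi> i), i mod n))" using finite_imageD infinite_UNIV_nat by blast
  then obtain i j where ij: "i < j" "\<phi> i = \<phi> j" "i mod n = j mod n"
    unfolding inj_def by (metis (no_types, lifting) Pair_inject fm.inject(3) linorder_neqE_nat)
  have "n dvd j - i" using ij(1,3) by (metis mod_eq_dvd_iff_nat less_imp_le_nat)
  then obtain k where "j - i = k * n" by (metis dvd_def mult.commute)
  moreover from this have "k \<noteq> 0" using ij(1) by (metis mult_is_0 zero_less_diff less_irrefl)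
  ultimately obtain k' where j: "j = i + n + k' * n" using ij(1)
    by (metis add.assoc le_add_diff_inverse less_imp_le_nat mult_Suc not0_implies_Suc)
  \<comment> \<open>The diagonal formula of step \<open>i\<close> decays to \<open>Box (\<phi> i)\<close> at \<open>i + n\<close>, which then recurs with period \<open>n\<close>.\<close>
  obtain m where m: "n = Suc m" using n by (cases n) auto
  have "(step n F ^^ m) (s (Suc i)) (s (Suc i + m))" using chain_pow[of "step n F"] s by blast
  moreover have "(Box ^^ (m + 1)) (\<phi> i) \<in> fst (s (Suc i))" using \<phi>[of i] m unfolding principal_def by simp
  ultimately have "Box (\<phi> i) \<in> fst (s (i + n))" 
    using step_pow_strip[where d = m and a = 1] m by fastforce
  moreover have "(step n F ^^ (k' * n)) (s (i + n)) (s j)"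
    unfolding j using chain_pow[of "step n F"] s by blast
  ultimately have "Box (\<phi> i) \<in> fst (s j)" using step_pow_period[OF n] by blast
  moreover have "Box (\<phi> i) \<in> snd (s j)" using \<phi>[of j] ij(2) unfolding principal_def by simp
  ultimately show False using world_Box_disjoint s unfolding step_def by blast
qed

text \<open>The closure of \<open>step\<close> under \<open>(n+1)\<close>-fold composition.\<close>
definition access :: "nat \<Rightarrow> fm set \<Rightarrow> world \<Rightarrow> world \<Rightarrow> bool" where
  "access n F w v \<longleftrightarrow> (\<exists>k. (step n F ^^ Suc (k * n)) w v)"

lemma access_pow: "(access n F ^^ m) w v \<Longrightarrow> \<exists>k. (step n F ^^ (m + k * n)) w v"
proof (induction m arbitrary: v)
  case 0
  then show ?case by (intro exI[of _ 0]) simp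
next
  case (Suc m)
  then obtain u where u: "(access n F ^^ m) w u" "access n F u v" by auto
  obtain k l where "(step n F ^^ (m + k * n)) w u" "(step n F ^^ Suc (l * n)) u v"
    using Suc.IH[OF u(1)] u(2) unfolding access_def by blast
  then have "(step n F ^^ ((m + k * n) + Suc (l * n))) w v" unfolding relpowp_add by blast
  then show ?case by (intro exI[of _ "k + l"]) (simp add: algebra_simps)
qed

lemma access_frame:
  assumes "n \<ge> 1" "finite F" shows "wGL_frame n (access n F)"
proof -
  have "access n F w v" if *: "(access n F ^^ Suc n) w v" for w v
  proof -
    obtain k where "(step n F ^^ (Suc n + k * n)) w v" using access_pow[OF *] by blast
    moreover have "Suc n + k * n = Suc (Suc k * n)" by simp
    ultimately show ?thesis unfolding access_def by metis
  qed
  moreover have "wfp (access n F)\<inverse>\<inverse>"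
  proof (rule wfp_subset)
    show "wfp ((step n F)\<inverse>\<inverse>\<^sup>+\<^sup>+)" using step_wf[OF assms] by (simp add: wfp_tranclp)
    show "(access n F)\<inverse>\<inverse> \<le> (step n F)\<inverse>\<inverse>\<^sup>+\<^sup>+"
    proof (intro predicate2I)
      fix v w assume "(access n F)\<inverse>\<inverse> v w"
      then have "(step n F)\<^sup>+\<^sup>+ w v" unfolding access_def conversep_iff tranclp_power by blast
      then show "(step n F)\<inverse>\<inverse>\<^sup>+\<^sup>+ v w" by (simp add: tranclp_converse)
    qed
  qed
  ultimately show ?thesis unfolding wGL_frame_def by blast
qed

lemma access_Box:
  assumes "n \<ge> 1" "access n F w v" "Box \<phi> \<in> fst w" shows "\<phi> \<in> fst v"
proof -
  obtain k u where "(step n F ^^ (k * n)) w u" "step n F u v"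
    using assms(2) unfolding access_def by auto
  then show ?thesis using step_pow_period[OF assms(1)] assms(3) unfolding step_def by blast
qed

lemma access_world: "access n F w v \<Longrightarrow> is_world n F v"
  unfolding access_def step_def by auto

lemma truth:
  assumes n: "n \<ge> 1" and F: "subfm_closed F"
  shows "is_world n F w \<Longrightarrow>
    (\<chi> \<in> fst w \<longrightarrow> sat (access n F) (\<lambda>w p. Var p \<in> fst w) w \<chi>)
    \<and> (\<chi> \<in> snd w \<longrightarrow> \<not> sat (access n F) (\<lambda>w p. Var p \<in> fst w) w \<chi>)"
proof (induction \<chi> arbitrary: w)
  case (Box \<phi>)
  let ?sat = "sat (access n F) (\<lambda>w p. Var p \<in> fst w)"
  have "?sat v \<phi>" if "Box \<phi> \<in> fst w" "access n F w v" for v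
    using Box.IH[OF access_world[OF that(2)]] access_Box[OF n that(2,1)] by blast
  moreover have "\<not> ?sat w (Box \<phi>)" if *: "Box \<phi> \<in> snd w"
  proof -
    obtain v where v: "step n F w v" "\<phi> \<in> snd v" using step_exists[OF F Box.prems *] by blast
    then have "access n F w v" unfolding access_def by (intro exI[of _ 0]) auto
    moreover have "\<not> ?sat v \<phi>" using Box.IH v unfolding step_def by blast
    ultimately show ?thesis unfolding sat.simps by blast
  qed
  ultimately show ?case unfolding sat.simps by blast
next
  case (Imp \<phi> \<psi>)
  have "Imp \<phi> \<psi> \<in> fst w \<longrightarrow> \<phi> \<in> snd w \<or> \<psi> \<in> fst w"
    and "Imp \<phi> \<psi> \<in> snd w \<longrightarrow> \<phi> \<in> fst w \<and> \<psi> \<in> snd w"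
    using Imp.prems unfolding is_world_def hintikka_def by simp_all
  then show ?case using Imp.IH[OF Imp.prems] unfolding sat.simps by blast
next
  case (Var p)
  then show ?case unfolding is_world_def hintikka_def sat.simps by blast
next
  case Bot
  then show ?case unfolding is_world_def hintikka_def sat.simps by blast
qed

text \<open>A sequent without a cut-free proof is refuted at the world that saturates it.\<close>
lemma complete:
  fixes S :: sequent
  assumes n: "n \<ge> 1"
    and holds: "\<And>R :: world \<Rightarrow> world \<Rightarrow> bool. \<And>V. wGL_frame n R \<Longrightarrow> holds R V S"
  shows "provable n S"
proof (rule ccontr)
  assume unp: "\<not> provable n S"
  define F where "F = (\<Union>\<phi>\<in>set_mset (fst S + snd S). subfms \<phi>)"
  have F: "subfm_closed F" "finite F"
  proof -
    show "subfm_closed F"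
      unfolding subfm_closed_def
    proof
      fix \<chi> assume "\<chi> \<in> F"
      then obtain \<phi> where "\<phi> \<in># fst S + snd S" "\<chi> \<in> subfms \<phi>" unfolding F_def by blast
      then show "subfms \<chi> \<subseteq> F" using subfms_trans unfolding F_def by blast
    qed
    show "finite F" unfolding F_def by (simp add: finite_subfms)
  qed
  have in_F: "\<phi> \<in> F" if "\<phi> \<in># fst S \<or> \<phi> \<in># snd S" for \<phi>
    unfolding F_def using that subfms_refl[of \<phi>] by auto
  obtain \<Gamma> \<Delta> where S: "S = (\<Gamma>, \<Delta>)" by (cases S)
  have "set_mset \<Gamma> \<subseteq> box_closure F" "set_mset \<Delta> \<subseteq> F"
    using in_F S by (auto intro: box_closure_base)
  then obtain A B where AB: "is_world n F (A, B)" "set_mset \<Gamma> \<subseteq> A" "set_mset \<Delta> \<subseteq> B"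
    using saturate[OF F(1)] unp S by blast
  let ?sat = "sat (access n F) (\<lambda>w p. Var p \<in> fst w)"
  have "?sat (A, B) \<phi>" if "\<phi> \<in># \<Gamma>" for \<phi>
    using truth[OF n F(1) AB(1)] AB(2) that by auto
  moreover have "\<not> ?sat (A, B) \<phi>" if "\<phi> \<in># \<Delta>" for \<phi>
    using truth[OF n F(1) AB(1)] AB(3) that by auto
  moreover have "holds (access n F) (\<lambda>w p. Var p \<in> fst w) S"
    by (rule holds[OF access_frame[OF n F(2)]])
  then have "(\<forall>\<phi>\<in>#\<Gamma>. ?sat (A, B) \<phi>) \<longrightarrow> (\<exists>\<psi>\<in>#\<Delta>. ?sat (A, B) \<psi>)"
    unfolding holds_def S fst_conv snd_conv by (rule spec)
  ultimately show False by blast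
qed

lemma cut_admissible:
  assumes "n \<ge> 1" and "proof_of n GwGL_Cut P S"
  shows "\<exists>Q. proof_of n GwGL Q S"
proof -
  have "locally_correct n GwGL_Cut P" "root P = S" using assms(2) by (auto simp: proof_of_def)
  then have "holds R V S" if "wGL_frame n R" for R :: "world \<Rightarrow> world \<Rightarrow> bool" and V
    using sound[OF assms(1) that, where P = P] by blast
  then have "provable n S" by (rule complete[OF assms(1)])
  then show ?thesis by (simp add: provable_def)
qed

section \<open>Computable functions\<close>

text \<open>Only unary functions are considered; further arguments are passed as nested pairs. This lets the
  closure properties below be stated for functions of one variable, so that computability of a concrete
  term is proved by following its syntax.\<close>
definition computable :: "(nat \<Rightarrow> nat) \<Rightarrow> bool" where
  "computable f \<longleftrightarrow> (\<exists>p. \<forall>x. computes p [x] (f x))"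

definition pair :: "nat \<Rightarrow> nat \<Rightarrow> nat" where
  "pair a b = prod_encode (a, b)"

definition left :: "nat \<Rightarrow> nat" where "left c = fst (prod_decode c)"
definition right :: "nat \<Rightarrow> nat" where "right c = snd (prod_decode c)"

lemma left_pair [simp]: "left (pair a b) = a" and right_pair [simp]: "right (pair a b) = b"
  by (simp_all add: left_def right_def pair_def)

lemma pair_left_right: "pair (left c) (right c) = c"
  by (simp add: left_def right_def pair_def)

lemma computes_Proj: "i < length xs \<Longrightarrow> xs ! i = y \<Longrightarrow> computes (Proj i) xs y"
  using computes.proj[of i xs] by simp

lemma computes_Comp1:
  assumes "computes g xs y" and "computes f [y] z"
  shows "computes (Comp f [g]) xs z"
proof (rule computes.comp)
  show "computes f [y] z" by fact
  show "computes ([g] ! i) xs ([y] ! i)" if "i < length [g]" for i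
    using that assms(1) by simp
qed simp

lemma computes_Comp2:
  assumes "computes g xs y" and "computes h xs y'" and "computes f [y, y'] z"
  shows "computes (Comp f [g, h]) xs z"
proof (rule computes.comp)
  show "computes f [y, y'] z" by fact
  show "computes ([g, h] ! i) xs ([y, y'] ! i)" if "i < length [g, h]" for i
    using that assms(1,2) by (cases i) simp_all
qed simp

lemma computes_PrimRec:
  assumes "computes f xs (a 0)" and "\<And>x. computes g (a x # x # xs) (a (Suc x))"
  shows "computes (PrimRec f g) (x # xs) (a x)"
proof (induction x)
  case 0
  show ?case by (rule computes.primrec_0[OF assms(1)])
next
  case (Suc x)
  show ?case by (rule computes.primrec_Suc[OF Suc assms(2)])
qed

definition add_rec :: recf where "add_rec = PrimRec (Proj 0) (Comp Succ [Proj 0])"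

lemma add_rec: "computes add_rec [x, y] (x + y)"
  unfolding add_rec_def
  by (rule computes_PrimRec) (auto intro!: computes_Proj computes_Comp1 computes.succ)

definition pred_rec :: recf where "pred_rec = PrimRec Zero (Proj 1)"

lemma pred_rec: "computes pred_rec [x] (x - 1)"
  unfolding pred_rec_def
  by (rule computes_PrimRec) (auto intro!: computes_Proj computes.zero)

definition monus_rec :: recf where "monus_rec = PrimRec (Proj 0) (Comp pred_rec [Proj 0])"

lemma monus_rec: "computes monus_rec [x, y] (y - x)"
proof -
  have "computes (Comp pred_rec [Proj 0]) [y - x, x, y] (y - Suc x)" for x
    by (rule computes_Comp1[OF computes_Proj[OF _ refl]]) (use pred_rec[of "y - x"] in auto)
  then show ?thesis
    unfolding monus_rec_def
    by (intro computes_PrimRec[where a = "\<lambda>x. y - x"]) (auto intro!: computes_Proj)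
qed

definition triangle_rec :: recf where
  "triangle_rec = PrimRec Zero (Comp Succ [Comp add_rec [Proj 0, Proj 1]])"

lemma triangle_rec: "computes triangle_rec [x] (triangle x)"
proof -
  have "computes (Comp Succ [Comp add_rec [Proj 0, Proj 1]]) [triangle x, x] (triangle (Suc x))" for x
  proof (rule computes_Comp1)
    show "computes (Comp add_rec [Proj 0, Proj 1]) [triangle x, x] (triangle x + x)"
      by (rule computes_Comp2[OF _ _ add_rec]) (auto intro!: computes_Proj)
    show "computes Succ [triangle x + x] (triangle (Suc x))"
      using computes.succ[of "triangle x + x"] by simp
  qed
  then show ?thesis
    unfolding triangle_rec_def
    by (intro computes_PrimRec[where a = triangle]) (auto intro!: computes.zero)
qed

definition pair_rec :: recf where
  "pair_rec = Comp add_rec [Comp triangle_rec [add_rec], Proj 0]"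

lemma pair_rec: "computes pair_rec [x, y] (pair x y)"
  unfolding pair_rec_def pair_def prod_encode_def prod.case
  by (rule computes_Comp2[OF computes_Comp1[OF add_rec triangle_rec] _ add_rec])
    (auto intro!: computes_Proj)

lemma triangle_mono: "i \<le> j \<Longrightarrow> triangle i \<le> triangle j"
  by (induction j) (auto simp: le_Suc_eq)

text \<open>Unpairing: \<open>pair a b\<close> lies between the triangular numbers of \<open>a + b\<close> and of \<open>a + b + 1\<close>, so
  \<open>a + b\<close> is the least \<open>s\<close> for which the triangular number of \<open>s + 1\<close> exceeds the pair.\<close>
definition diagonal_rec :: recf where
  "diagonal_rec = Mu (Comp monus_rec [Comp triangle_rec [Comp Succ [Proj 0]], Comp Succ [Proj 1]])"

lemma diagonal_rec: "computes diagonal_rec [pair a b] (a + b)"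
proof -
  let ?f = "Comp monus_rec [Comp triangle_rec [Comp Succ [Proj 0]], Comp Succ [Proj 1]]"
  have f: "computes ?f [s, c] (Suc c - triangle (Suc s))" for s c
  proof (rule computes_Comp2[OF _ _ monus_rec])
    show "computes (Comp triangle_rec [Comp Succ [Proj 0]]) [s, c] (triangle (Suc s))"
      by (rule computes_Comp1[OF computes_Comp1[OF computes_Proj computes.succ] triangle_rec]) auto
    show "computes (Comp Succ [Proj 1]) [s, c] (Suc c)"
      by (rule computes_Comp1[OF computes_Proj computes.succ]) auto
  qed
  show ?thesis
    unfolding diagonal_rec_def
  proof (rule computes.mu)
    show "computes ?f [a + b, pair a b] 0"
      using f[of "a + b" "pair a b"] by (simp add: pair_def prod_encode_def)
    fix s assume "s < a + b"
    then have "triangle (Suc s) \<le> pair a b"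
      using triangle_mono[of "Suc s" "a + b"] by (simp add: pair_def prod_encode_def)
    then have "Suc (pair a b) - triangle (Suc s) = Suc (pair a b - triangle (Suc s))" by simp
    then show "\<exists>v. computes ?f [s, pair a b] (Suc v)" using f[of s "pair a b"] by metis
  qed
qed

definition left_rec :: recf where
  "left_rec = Comp monus_rec [Comp triangle_rec [diagonal_rec], Proj 0]"

lemma left_rec: "computes left_rec [c] (left c)"
proof -
  define a b where "a = left c" and "b = right c"
  have c: "c = pair a b" by (simp add: a_def b_def pair_left_right)
  have "computes left_rec [pair a b] (pair a b - triangle (a + b))"
    unfolding left_rec_def
    by (rule computes_Comp2[OF computes_Comp1[OF diagonal_rec triangle_rec] _ monus_rec])
      (auto intro!: computes_Proj)
  then show ?thesis by (simp add: c) (simp add: pair_def prod_encode_def)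
qed

definition right_rec :: recf where
  "right_rec = Comp monus_rec [left_rec, diagonal_rec]"

lemma right_rec: "computes right_rec [c] (right c)"
proof -
  define a b where "a = left c" and "b = right c"
  have c: "c = pair a b" by (simp add: a_def b_def pair_left_right)
  have "computes right_rec [pair a b] (a + b - left (pair a b))"
    unfolding right_rec_def by (rule computes_Comp2[OF left_rec diagonal_rec monus_rec])
  then show ?thesis by (simp add: c)
qed

lemma computable_id: "computable (\<lambda>x. x)"
  unfolding computable_def by (auto intro!: exI[of _ "Proj 0"] computes_Proj)

lemma computable_const: "computable (\<lambda>_. c)"
proof (induction c)
  case 0
  then show ?case unfolding computable_def using computes.zero by blast
next
  case (Suc c)
  then show ?case unfolding computable_def using computes_Comp1 computes.succ by meson
qed

lemma computable_comp: "computable f \<Longrightarrow> computable g \<Longrightarrow> computable (\<lambda>x. f (g x))"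
  unfolding computable_def using computes_Comp1 by meson

lemma computable_apply2:
  assumes "\<And>x y. computes p [x, y] (h x y)" and "computable f" and "computable g"
  shows "computable (\<lambda>x. h (f x) (g x))"
  using assms(2,3) computes_Comp2[OF _ _ assms(1)] unfolding computable_def by meson

lemma computable_Suc: "computable f \<Longrightarrow> computable (\<lambda>x. Suc (f x))"
  unfolding computable_def using computes_Comp1 computes.succ by meson

lemmas computable_pair = computable_apply2[OF pair_rec]

lemma computable_diff: "computable f \<Longrightarrow> computable g \<Longrightarrow> computable (\<lambda>x. f x - g x)"
  using computable_apply2[OF monus_rec] .

lemma computable_left: "computable f \<Longrightarrow> computable (\<lambda>x. left (f x))"
  by (rule computable_comp[of left]) (use left_rec in \<open>auto simp: computable_def\<close>)

lemma computable_right: "computable f \<Longrightarrow> computable (\<lambda>x. right (f x))"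
  by (rule computable_comp[of right]) (use right_rec in \<open>auto simp: computable_def\<close>)

text \<open>The variable \<open>y\<close> in the second premise packs the parameter \<open>x\<close>, the recursion variable \<open>m\<close> and the previous
  value \<open>r\<close>.\<close>
lemma computable_rec_nat:
  assumes "computable a" and "computable (\<lambda>y. g (left y) (left (right y)) (right (right y)))"
    and "computable k"
  shows "computable (\<lambda>x. rec_nat (a x) (\<lambda>m r. g x m r) (k x))"
proof -
  obtain pa pg pk where p: "\<And>x. computes pa [x] (a x)" "\<And>x. computes pk [x] (k x)"
      "\<And>y. computes pg [y] (g (left y) (left (right y)) (right (right y)))"
    using assms unfolding computable_def by metis
  let ?step = "Comp pg [Comp pair_rec [Proj 2, Comp pair_rec [Proj 1, Proj 0]]]"
  have step: "computes ?step [r, m, x] (g x m r)" for r m x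
  proof -
    have "computes (Comp pair_rec [Proj 2, Comp pair_rec [Proj 1, Proj 0]]) [r, m, x] (pair x (pair m r))"
      by (rule computes_Comp2[OF computes_Proj computes_Comp2[OF computes_Proj computes_Proj pair_rec] pair_rec])
        auto
    from computes_Comp1[OF this p(3)] show ?thesis by simp
  qed
  have "computes (PrimRec pa ?step) [m, x] (rec_nat (a x) (\<lambda>m r. g x m r) m)" for m x
    by (rule computes_PrimRec) (use p(1) step in auto)
  from computes_Comp2[OF p(2) computes_Proj[of 0] this]
  have "computes (Comp (PrimRec pa ?step) [pk, Proj 0]) [x] (rec_nat (a x) (\<lambda>m r. g x m r) (k x))" for x
    by simp
  then show ?thesis unfolding computable_def by blast
qed

definition decidable :: "(nat \<Rightarrow> bool) \<Rightarrow> bool" where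
  "decidable P \<longleftrightarrow> computable (\<lambda>x. of_bool (P x))"

lemma computable_if:
  assumes "decidable P" "computable f" "computable g"
  shows "computable (\<lambda>x. if P x then f x else g x)"
proof -
  have "computable (\<lambda>x. rec_nat (g x) (\<lambda>m r. f x) (of_bool (P x)))"
    using assms computable_comp[OF assms(2) computable_left[OF computable_id]]
    unfolding decidable_def by (intro computable_rec_nat)
  moreover have "rec_nat (g x) (\<lambda>m r. f x) (of_bool (P x)) = (if P x then f x else g x)" for x by simp
  ultimately show ?thesis by simp
qed

lemma decidable_le:
  assumes "computable f" "computable g" shows "decidable (\<lambda>x. f x \<le> g x)"
proof -
  have "computable (\<lambda>x. 1 - (f x - g x))"
    using assms by (intro computable_diff computable_const)
  moreover have "1 - (f x - g x) = of_bool (f x \<le> g x)" for x by simp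
  ultimately show ?thesis unfolding decidable_def by simp
qed

lemma decidable_conj:
  assumes "decidable P" "decidable Q" shows "decidable (\<lambda>x. P x \<and> Q x)"
proof -
  have "computable (\<lambda>x. if P x then of_bool (Q x) else 0)"
    using assms by (intro computable_if computable_const) (simp_all add: decidable_def)
  moreover have "(if P x then of_bool (Q x) else 0) = (of_bool (P x \<and> Q x) :: nat)" for x by simp
  ultimately show ?thesis unfolding decidable_def by simp
qed

lemma decidable_eq:
  assumes "computable f" "computable g" shows "decidable (\<lambda>x. f x = g x)"
  using decidable_conj[OF decidable_le[OF assms] decidable_le[OF assms(2,1)]]
  by (simp add: eq_iff)

text \<open>Nesting pairs with the latest value outermost makes earlier values accessible by iterating
  \<open>right\<close>, for which primitive recursion is enough.\<close>
primrec history :: "(nat \<Rightarrow> nat) \<Rightarrow> nat \<Rightarrow> nat" where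
  "history f 0 = 0"
| "history f (Suc t) = pair (f t) (history f t)"

definition lookup :: "nat \<Rightarrow> nat \<Rightarrow> nat \<Rightarrow> nat" where
  "lookup t h i = left (rec_nat h (\<lambda>_. right) (t - Suc i))"

lemma lookup_history:
  assumes "i < t" shows "lookup t (history f t) i = f i"
proof -
  have "rec_nat (history f (k + Suc i)) (\<lambda>_. right) k = history f (Suc i)" for k
  proof (induction k)
    case (Suc k)
    have "rec_nat h (\<lambda>_. right) (Suc k) = rec_nat (right h) (\<lambda>_. right) k" for h
      by (induction k) auto
    then show ?case using Suc by simp
  qed simp
  from this[of "t - Suc i"] show ?thesis using assms by (simp add: lookup_def)
qed

lemma computable_lookup:
  assumes "computable t" "computable h" "computable i"
  shows "computable (\<lambda>x. lookup (t x) (h x) (i x))"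
  unfolding lookup_def using assms
  by (intro computable_left computable_rec_nat computable_right computable_diff computable_Suc computable_id)

text \<open>\<open>H\<close> obtains the value of \<open>f x\<close> at \<open>t\<close> from the history of the smaller arguments, which by itself
  is defined by primitive recursion.\<close>
lemma computable_course_of_values:
  assumes H: "computable (\<lambda>y. H (left y) (left (right y)) (right (right y)))"
    and eq: "\<And>x t. f x t = H x t (history (f x) t)"
    and a: "computable a" and b: "computable b"
  shows "computable (\<lambda>x. f (a x) (b x))"
proof -
  have H': "computable (\<lambda>x. H (u x) (v x) (w x))"
    if "computable u" "computable v" "computable w" for u v w
    using computable_comp[OF H, of "\<lambda>x. pair (u x) (pair (v x) (w x))"] that
    by (simp add: computable_pair)
  have "history (f x) t = rec_nat 0 (\<lambda>m r. pair (H x m r) r) t" for x t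
  proof (induction t)
    case (Suc t)
    then show ?case using eq[of x t] by simp
  qed simp
  moreover have "computable (\<lambda>x. rec_nat 0 (\<lambda>m r. pair (H (a x) m r) r) (b x))"
    by (intro computable_rec_nat computable_pair H' computable_const b computable_left
      computable_right computable_id computable_comp[OF a computable_left[OF computable_id]])
  ultimately have "computable (\<lambda>x. history (f (a x)) (b x))" by simp
  then have "computable (\<lambda>x. H (a x) (b x) (history (f (a x)) (b x)))"
    by (rule H'[OF a b])
  then show ?thesis by (simp only: eq[symmetric])
qed

section \<open>Computing with codes of formulas and sequents\<close>

lemmas computable_arith = computable_id computable_const computable_pair computable_left
  computable_right computable_Suc computable_diff computable_if
  decidable_eq decidable_le decidable_conj computable_lookup

lemma left_le: "left c \<le> c"
  by (metis le_prod_encode_1 pair_def pair_left_right)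

lemma right_le: "right c \<le> c"
  by (metis le_prod_encode_2 pair_def pair_left_right)

lemma right_less:
  assumes "left c \<noteq> 0" shows "right c < c"
proof -
  have "c = triangle (left c + right c) + left c"
    using pair_left_right[of c] by (simp add: pair_def prod_encode_def)
  moreover have "k \<le> triangle k" for k by (induction k) auto
  from this[of "left c + right c"] have "right c \<le> triangle (left c + right c)" by simp
  ultimately show ?thesis using assms by linarith
qed

text \<open>Recursion over a coded list is course-of-values recursion because the code of a list exceeds that of
  its tail.\<close>
lemma computable_rec_list:
  assumes a: "computable a"
    and g: "computable (\<lambda>y. g (left y) (left (right y)) (left (right (right y))) (right (right (right y))))"
    and l: "computable l"
  shows "computable (\<lambda>x. rec_list (a x) (\<lambda>u us r. g x u (list_encode us) r) (list_decode (l x)))"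
proof (rule computable_course_of_values[where a = "\<lambda>x. x" and b = l and
      f = "\<lambda>x t. rec_list (a x) (\<lambda>u us r. g x u (list_encode us) r) (list_decode t)" and
      H = "\<lambda>x t h. if t = 0 then a x else g x (left (t - 1)) (right (t - 1)) (lookup t h (right (t - 1)))"])
  have g': "computable (\<lambda>x. g (p x) (q x) (r x) (s x))"
    if "computable p" "computable q" "computable r" "computable s" for p q r s
    using computable_comp[OF g, of "\<lambda>x. pair (p x) (pair (q x) (pair (r x) (s x)))"] that
    by (simp add: computable_pair)
  show "computable (\<lambda>y. if left (right y) = 0 then a (left y)
      else g (left y) (left (left (right y) - 1)) (right (left (right y) - 1))
        (lookup (left (right y)) (right (right y)) (right (left (right y) - 1))))"
    by (intro computable_arith g' computable_comp[OF a computable_left[OF computable_id]])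
  fix x t
  show "rec_list (a x) (\<lambda>u us r. g x u (list_encode us) r) (list_decode t) =
    (if t = 0 then a x else g x (left (t - 1)) (right (t - 1))
      (lookup t (history (\<lambda>t. rec_list (a x) (\<lambda>u us r. g x u (list_encode us) r) (list_decode t)) t)
        (right (t - 1))))"
  proof (cases t)
    case (Suc c)
    then have "right c < t" using right_le[of c] by simp
    then show ?thesis using Suc
      by (simp add: lookup_history left_def right_def split: prod.split del: history.simps)
  qed simp
qed (use l computable_id in auto)

text \<open>Codes of multisets are sorted, hence adding an element is an insertion into a sorted list.\<close>
lemma list_encode_insort:
  "list_encode (insort u vs) = rec_list (Suc (pair u 0))
     (\<lambda>v vs r. if u \<le> v then Suc (pair u (Suc (pair v (list_encode vs)))) else Suc (pair v r)) vs"
  by (induction vs) (simp_all add: pair_def)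

lemma computable_insort:
  assumes "computable u" "computable l"
  shows "computable (\<lambda>x. list_encode (insort (u x) (list_decode (l x))))"
  unfolding list_encode_insort
  by (intro computable_rec_list[where g = "\<lambda>x v t r. if u x \<le> v then Suc (pair (u x) (Suc (pair v t)))
        else Suc (pair v r)"] computable_arith assms
      computable_comp[OF assms(1) computable_left[OF computable_id]])

lemma mset_code_add: 
  "mset_code (add_mset \<phi> \<Gamma>) = list_encode (insort (fm_code \<phi>) (list_decode (mset_code \<Gamma>)))"
  by (simp add: mset_code_def)

lemma computable_add_mset:
  "computable (\<lambda>x. fm_code (\<phi> x)) \<Longrightarrow> computable (\<lambda>x. mset_code (\<Gamma> x)) \<Longrightarrow>
    computable (\<lambda>x. mset_code (add_mset (\<phi> x) (\<Gamma> x)))"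
  unfolding mset_code_add by (rule computable_insort)

lemma computable_image_mset_plus:
  assumes h: "computable (\<lambda>c. fm_code (h c))" and l: "computable l"
    and \<Gamma>: "computable (\<lambda>x. mset_code (\<Gamma> x))"
  shows "computable (\<lambda>x. mset_code (image_mset h (mset (list_decode (l x))) + \<Gamma> x))"
proof -
  have eq: "mset_code (image_mset h (mset us) + \<Gamma> x) = rec_list (mset_code (\<Gamma> x))
      (\<lambda>u us r. list_encode (insort (fm_code (h u)) (list_decode r))) us" for us x
    by (induction us) (simp_all add: mset_code_add)
  show ?thesis
    unfolding eq
    by (intro computable_rec_list[where g = "\<lambda>x u t r. list_encode (insort (fm_code (h u)) (list_decode r))"]
        \<Gamma> l computable_insort computable_comp[OF h] computable_left computable_right computable_id)
qed

text \<open>A component without one of the tags 0, 2 and 3 is read as \<open>Bot\<close>. Since every number denotes a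
  formula, the enumeration of proofs need not recognise valid codes.\<close>
function dec :: "nat \<Rightarrow> fm" where
  "dec c = (if left c = 0 then Var (right c)
     else if left c = 2 then Imp (dec (left (right c))) (dec (right (right c)))
     else if left c = 3 then Box (dec (right c))
     else Bot)"
  by pat_completeness auto
termination
proof (relation "measure id")
  show "(left (right c), c) \<in> measure id" if "left c \<noteq> 0" for c
    using right_less[OF that] left_le[of "right c"] by simp
  show "(right (right c), c) \<in> measure id" if "left c \<noteq> 0" for c
    using right_less[OF that] right_le[of "right c"] by simp
  show "(right c, c) \<in> measure id" if "left c \<noteq> 0" for c
    using right_less[OF that] by simp
qed simp

declare dec.simps [simp del]

lemma dec_fm_code: "dec (fm_code \<phi>) = \<phi>"
  by (induction \<phi>) (subst dec.simps, simp flip: pair_def)+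

lemma computable_dec:
  assumes "computable a" shows "computable (\<lambda>x. fm_code (dec (a x)))"
proof (rule computable_course_of_values[where a = a and b = a and f = "\<lambda>_ t. fm_code (dec t)" and
      H = "\<lambda>_ t h. if left t = 0 then pair 0 (right t)
        else if left t = 2 then pair 2 (pair (lookup t h (left (right t))) (lookup t h (right (right t))))
        else if left t = 3 then pair 3 (lookup t h (right t))
        else pair 1 0"])
  show "fm_code (dec t) = (if left t = 0 then pair 0 (right t)
      else if left t = 2 then pair 2 (pair (lookup t (history (\<lambda>t. fm_code (dec t)) t) (left (right t)))
        (lookup t (history (\<lambda>t. fm_code (dec t)) t) (right (right t))))
      else if left t = 3 then pair 3 (lookup t (history (\<lambda>t. fm_code (dec t)) t) (right t))
      else pair 1 0)" for t
  proof (cases "left t = 0")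
    case False
    then have "right t < t" by (rule right_less)
    then have "left (right t) < t" "right (right t) < t"
      using left_le[of "right t"] right_le[of "right t"] by auto
    then show ?thesis
      using \<open>right t < t\<close> by (subst dec.simps) (simp add: lookup_history flip: pair_def)
  qed (subst dec.simps, simp flip: pair_def)
qed (use assms in \<open>intro computable_arith | assumption\<close>)+

definition formulas :: "nat \<Rightarrow> fm multiset" where
  "formulas l = image_mset dec (mset (list_decode l))"

lemma formulas_surj: "\<exists>l. formulas l = \<Gamma>"
proof -
  obtain xs where "mset xs = \<Gamma>" using ex_mset by blast
  then have "formulas (list_encode (map fm_code xs)) = \<Gamma>"
    by (simp add: formulas_def dec_fm_code multiset.map_comp comp_def flip: mset_map)
  then show ?thesis by blast
qed

lemma computable_formulas:
  assumes "computable l" shows "computable (\<lambda>x. mset_code (formulas (l x)))"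
  using computable_image_mset_plus[OF computable_dec[OF computable_id] assms, of "\<lambda>_. {#}"] computable_const
  by (simp add: formulas_def)

lemma computable_image_formulas_plus:
  assumes "computable (\<lambda>c. fm_code (h (dec c)))" "computable l" "computable (\<lambda>x. mset_code (\<Gamma> x))"
  shows "computable (\<lambda>x. mset_code (image_mset h (formulas (l x)) + \<Gamma> x))"
  using computable_image_mset_plus[OF assms] by (simp add: formulas_def multiset.map_comp comp_def)

lemma computable_Box_pow:
  "computable (\<lambda>x. fm_code (\<phi> x)) \<Longrightarrow> computable (\<lambda>x. fm_code ((Box ^^ k) (\<phi> x)))"
proof (induction k)
  case (Suc k)
  then have "computable (\<lambda>x. pair 3 (fm_code ((Box ^^ k) (\<phi> x))))"
    by (intro computable_pair computable_const)
  then show ?case by (simp add: pair_def)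
qed simp

lemma computable_Imp:
  assumes "computable (\<lambda>x. fm_code (\<phi> x))" "computable (\<lambda>x. fm_code (\<psi> x))"
  shows "computable (\<lambda>x. fm_code (Imp (\<phi> x) (\<psi> x)))"
proof -
  have "computable (\<lambda>x. pair 2 (pair (fm_code (\<phi> x)) (fm_code (\<psi> x))))"
    using assms by (intro computable_pair computable_const)
  then show ?thesis by (simp add: pair_def)
qed

lemma computable_Var:
  assumes "computable a" shows "computable (\<lambda>x. fm_code (Var (a x)))"
  using computable_pair[OF computable_const[of 0] assms] by (simp add: pair_def)

lemma computable_sequent:
  assumes "computable (\<lambda>x. mset_code (\<Gamma> x))" "computable (\<lambda>x. mset_code (\<Delta> x))"
  shows "computable (\<lambda>x. sequent_code (\<Gamma> x, \<Delta> x))"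
  using computable_pair[OF assms] by (simp add: sequent_code_def pair_def)

section \<open>An enumeration of the cut-free proofs\<close>

text \<open>The number \<open>q\<close> holds all parameters that any rule may need: two formulas, the contexts
  on both sides, and the multiset \<open>\<Sigma>\<close> of the rule for \<open>Box\<close>.\<close>
definition first_fm :: "nat \<Rightarrow> fm" where "first_fm q = dec (left q)"
definition second_fm :: "nat \<Rightarrow> fm" where "second_fm q = dec (left (right q))"
definition antecedent :: "nat \<Rightarrow> fm multiset" where "antecedent q = formulas (left (right (right q)))"
definition succedent :: "nat \<Rightarrow> fm multiset" where "succedent q = formulas (left (right (right (right q))))"
definition to_box :: "nat \<Rightarrow> fm multiset" where "to_box q = formulas (right (right (right (right q))))"

lemma params_exist: "\<exists>q. left q = c \<and> second_fm q = \<psi> \<and> antecedent q = \<Gamma> \<and> succedent q = \<Delta> \<and> to_box q = \<Sigma>"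
proof -
  obtain g d s where "formulas g = \<Gamma>" "formulas d = \<Delta>" "formulas s = \<Sigma>"
    using formulas_surj by metis
  then show ?thesis
    by (intro exI[of _ "pair c (pair (fm_code \<psi>) (pair g (pair d s)))"])
      (simp add: second_fm_def antecedent_def succedent_def to_box_def dec_fm_code)
qed

definition axiom_node :: "nat \<Rightarrow> ptree" where
  "axiom_node q = Node (add_mset (Var (left q)) (antecedent q), add_mset (Var (left q)) (succedent q)) Ax []"

text \<open>The rule numbered \<open>r\<close> with parameters \<open>q\<close> is applied to the proofs \<open>P\<close> and \<open>Q\<close> if their end sequents
  are its premises. In all other cases the result is an instance of BotL, so that it
  is always a correct proof.\<close>
definition infer :: "nat \<Rightarrow> nat \<Rightarrow> nat \<Rightarrow> ptree \<Rightarrow> ptree \<Rightarrow> ptree" where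
  "infer n r q P Q =
    (if r = 2 \<and> root P = (antecedent q, succedent q)
     then Node (antecedent q, add_mset Bot (succedent q)) BotR [P]
     else if r = 3 \<and> root P = (antecedent q, add_mset (first_fm q) (succedent q)) \<and> root Q = (add_mset (second_fm q) (antecedent q), succedent q)
     then Node (add_mset (Imp (first_fm q) (second_fm q)) (antecedent q), succedent q) ImpL [P, Q]
     else if r = 4 \<and> root P = (add_mset (first_fm q) (antecedent q), add_mset (second_fm q) (succedent q))
     then Node (antecedent q, add_mset (Imp (first_fm q) (second_fm q)) (succedent q)) ImpR [P]
     else if r = 5 \<and> root P = (add_mset ((Box ^^ n) (first_fm q)) (dotboxes n (to_box q)), {#first_fm q#})
     then Node (image_mset Box (to_box q) + antecedent q, add_mset (Box (first_fm q)) (succedent q)) BoxR [P]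
     else Node (add_mset Bot (antecedent q), succedent q) BotL [])"

text \<open>The counterpart of \<open>infer\<close> on codes. It compares end sequents by their codes, which is sound as
  the coding is injective.\<close>
definition infer_code :: "nat \<Rightarrow> nat \<Rightarrow> nat \<Rightarrow> nat \<Rightarrow> nat \<Rightarrow> nat" where
  "infer_code n r q p p' =
    (if r = 2 \<and> left p = sequent_code (antecedent q, succedent q)
     then pair (sequent_code (antecedent q, add_mset Bot (succedent q))) (pair 2 (Suc (pair p 0)))
     else if r = 3 \<and> left p = sequent_code (antecedent q, add_mset (first_fm q) (succedent q))
       \<and> left p' = sequent_code (add_mset (second_fm q) (antecedent q), succedent q)
     then pair (sequent_code (add_mset (Imp (first_fm q) (second_fm q)) (antecedent q), succedent q))
       (pair 3 (Suc (pair p (Suc (pair p' 0)))))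
     else if r = 4 \<and> left p = sequent_code (add_mset (first_fm q) (antecedent q), add_mset (second_fm q) (succedent q))
     then pair (sequent_code (antecedent q, add_mset (Imp (first_fm q) (second_fm q)) (succedent q))) (pair 4 (Suc (pair p 0)))
     else if r = 5
       \<and> left p = sequent_code (add_mset ((Box ^^ n) (first_fm q)) (dotboxes n (to_box q)), {#first_fm q#})
     then pair (sequent_code (image_mset Box (to_box q) + antecedent q, add_mset (Box (first_fm q)) (succedent q)))
       (pair 5 (Suc (pair p 0)))
     else pair (sequent_code (add_mset Bot (antecedent q), succedent q)) (pair 1 0))"

lemma left_ptree_code: "left (ptree_code P) = sequent_code (root P)"
  by (cases P) (simp flip: pair_def)

lemma infer_code: "infer_code n r q (ptree_code P) (ptree_code Q) = ptree_code (infer n r q P Q)"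
  unfolding infer_code_def infer_def left_ptree_code sequent_code_inject
  by (auto simp flip: pair_def)

lemma infer_correct:
  assumes "locally_correct n GwGL P" "locally_correct n GwGL Q"
  shows "locally_correct n GwGL (infer n r q P Q)"
  using assms unfolding infer_def by (auto simp: GwGL_def intro: rule_instance.intros)

lemma computable_infer_code:
  assumes r: "computable r" and q: "computable q" and p: "computable p" "computable p'"
  shows "computable (\<lambda>x. infer_code n (r x) (q x) (p x) (p' x))"
proof -
  have fm: "computable (\<lambda>x. fm_code (first_fm (q x)))" "computable (\<lambda>x. fm_code (second_fm (q x)))"
    unfolding first_fm_def second_fm_def by (intro computable_dec computable_left computable_right q)+
  have ms: "computable (\<lambda>x. mset_code (antecedent (q x)))" "computable (\<lambda>x. mset_code (succedent (q x)))"
     "computable (\<lambda>x. mset_code (to_box (q x)))"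
    unfolding antecedent_def succedent_def to_box_def
    by (intro computable_formulas computable_left computable_right q)+
  have box: "computable (\<lambda>x. fm_code (Box (\<phi> x)))" if "computable (\<lambda>x. fm_code (\<phi> x))" for \<phi>
    using computable_Box_pow[OF that, of 1] by simp
  have to_box: "computable (\<lambda>x. mset_code (image_mset (Box ^^ k) (to_box (q x)) + \<Gamma> x))"
    if "computable (\<lambda>x. mset_code (\<Gamma> x))" for k \<Gamma>
    unfolding to_box_def
    by (intro computable_image_formulas_plus computable_Box_pow computable_dec computable_right
        computable_id q that)
  note to_box1 = to_box[of _ 1, simplified]
  show ?thesis
    unfolding infer_code_def
    by (intro computable_if decidable_conj decidable_eq computable_pair computable_Suc computable_left
        computable_sequent computable_add_mset computable_Imp computable_Box_pow box to_box to_box1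
        fm ms r q p computable_const)
qed

text \<open>A number is read as a rule, two numbers of proofs for the premises, and parameters. The rule number 0
  stands for an axiom and carries parameters only; for other rules the two
  smaller numbers strictly decrease.\<close>
function nth_proof :: "nat \<Rightarrow> nat \<Rightarrow> ptree" where
  "nth_proof n t = (if left t = 0 then axiom_node (right t)
     else infer n (left t) (right (right (right t))) (nth_proof n (left (right t))) (nth_proof n (left (right (right t)))))"
  by pat_completeness auto
termination
proof (relation "measure snd")
  show "((n, left (right t)), n, t) \<in> measure snd" if "left t \<noteq> 0" for n t
    using right_less[OF that] left_le[of "right t"] by simp
  show "((n, left (right (right t))), n, t) \<in> measure snd" if "left t \<noteq> 0" for n t
    using right_less[OF that] left_le[of "right (right t)"] right_le[of "right t"] by simp
qed simp

declare nth_proof.simps [simp del]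

lemma nth_proof_correct: "locally_correct n GwGL (nth_proof n t)"
proof (induction n t rule: nth_proof.induct)
  case (1 n t)
  have "locally_correct n GwGL (axiom_node q)" for q
    by (simp add: axiom_node_def GwGL_def rule_instance.ax)
  then show ?case using 1 by (subst nth_proof.simps) (simp add: infer_correct)
qed

lemma nth_proof_axiom: "nth_proof n (pair 0 q) = axiom_node q"
  by (subst nth_proof.simps) simp

lemma nth_proof_infer: "r \<noteq> 0 \<Longrightarrow> nth_proof n (pair r (pair t (pair t' q))) = infer n r q (nth_proof n t) (nth_proof n t')"
  by (subst nth_proof.simps) simp

lemma nth_proof_complete: "locally_correct n GwGL P \<Longrightarrow> \<exists>t. nth_proof n t = P"
proof (induction P)
  case (Node S r Ps)
  have rule: "rule_instance n r (map root Ps) S" and r: "r \<in> GwGL" using Node.prems by auto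
  have prem: "\<exists>t. nth_proof n t = P" if "P \<in> set Ps" for P using Node that by auto
  from rule show ?case
  proof cases
    case (ax p \<Gamma> \<Delta>)
    obtain q where "left q = p" "antecedent q = \<Gamma>" "succedent q = \<Delta>" using params_exist by metis
    then have "nth_proof n (pair 0 q) = Node S r Ps" using ax by (simp add: nth_proof_axiom axiom_node_def)
    then show ?thesis by blast
  next
    case (botL \<Gamma> \<Delta>)
    obtain q where "antecedent q = \<Gamma>" "succedent q = \<Delta>" using params_exist by metis
    then have "nth_proof n (pair 1 (pair 0 (pair 0 q))) = Node S r Ps"
      using botL by (simp add: nth_proof_infer infer_def)
    then show ?thesis by blast
  next
    case (botR \<Gamma> \<Delta>)
    then obtain P where P: "Ps = [P]" "root P = (\<Gamma>, \<Delta>)" by auto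
    obtain t where t: "nth_proof n t = P" using prem P by auto
    obtain q where "antecedent q = \<Gamma>" "succedent q = \<Delta>" using params_exist by metis
    then have "nth_proof n (pair 2 (pair t (pair 0 q))) = Node S r Ps"
      using botR P t by (simp add: nth_proof_infer infer_def)
    then show ?thesis by blast
  next
    case (impL \<Gamma> \<phi> \<Delta> \<psi>)
    then obtain P Q where P: "Ps = [P, Q]" "root P = (\<Gamma>, add_mset \<phi> \<Delta>)" "root Q = (add_mset \<psi> \<Gamma>, \<Delta>)"
      by auto
    obtain t t' where t: "nth_proof n t = P" "nth_proof n t' = Q" using prem P by (metis list.set_intros)
    obtain q where "left q = fm_code \<phi>" "second_fm q = \<psi>" "antecedent q = \<Gamma>" "succedent q = \<Delta>" using params_exist by metis
    then have "nth_proof n (pair 3 (pair t (pair t' q))) = Node S r Ps"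
      using impL P t by (simp add: nth_proof_infer infer_def first_fm_def dec_fm_code)
    then show ?thesis by blast
  next
    case (impR \<phi> \<Gamma> \<psi> \<Delta>)
    then obtain P where P: "Ps = [P]" "root P = (add_mset \<phi> \<Gamma>, add_mset \<psi> \<Delta>)" by auto
    obtain t where t: "nth_proof n t = P" using prem P by auto
    obtain q where "left q = fm_code \<phi>" "second_fm q = \<psi>" "antecedent q = \<Gamma>" "succedent q = \<Delta>" using params_exist by metis
    then have "nth_proof n (pair 4 (pair t (pair 0 q))) = Node S r Ps"
      using impR P t by (simp add: nth_proof_infer infer_def first_fm_def dec_fm_code)
    then show ?thesis by blast
  next
    case (boxR \<phi> \<Sigma> \<Gamma> \<Delta>)
    then obtain P where P: "Ps = [P]" "root P = (add_mset ((Box ^^ n) \<phi>) (dotboxes n \<Sigma>), {#\<phi>#})" by auto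
    obtain t where t: "nth_proof n t = P" using prem P by auto
    obtain q where "left q = fm_code \<phi>" "to_box q = \<Sigma>" "antecedent q = \<Gamma>" "succedent q = \<Delta>"
      using params_exist by metis
    then have "nth_proof n (pair 5 (pair t (pair 0 q))) = Node S r Ps"
      using boxR P t by (simp add: nth_proof_infer infer_def first_fm_def dec_fm_code)
    then show ?thesis by blast
  next
    case (cut \<Gamma> \<chi> \<Delta>)
    then show ?thesis using r by (simp add: GwGL_def)
  qed
qed

lemma computable_nth_proof: "computable (\<lambda>t. ptree_code (nth_proof n t))"
proof (rule computable_course_of_values[where a = "\<lambda>t. t" and b = "\<lambda>t. t"
      and f = "\<lambda>_ t. ptree_code (nth_proof n t)" and
      H = "\<lambda>_ t h. if left t = 0
        then pair (sequent_code (add_mset (Var (left (right t))) (antecedent (right t)),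
               add_mset (Var (left (right t))) (succedent (right t)))) (pair 0 0)
        else infer_code n (left t) (right (right (right t)))
          (lookup t h (left (right t))) (lookup t h (left (right (right t))))"])
  show "computable (\<lambda>y. if left (left (right y)) = 0
        then pair (sequent_code (add_mset (Var (left (right (left (right y))))) (antecedent (right (left (right y)))),
               add_mset (Var (left (right (left (right y))))) (succedent (right (left (right y)))))) (pair 0 0)
        else infer_code n (left (left (right y))) (right (right (right (left (right y)))))
          (lookup (left (right y)) (right (right y)) (left (right (left (right y)))))
          (lookup (left (right y)) (right (right y)) (left (right (right (left (right y)))))))"
    unfolding antecedent_def succedent_def
    by (intro computable_infer_code computable_arith computable_sequent computable_add_mset computable_Var
        computable_formulas)
  show "ptree_code (nth_proof n t) = (if left t = 0
        then pair (sequent_code (add_mset (Var (left (right t))) (antecedent (right t)),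
               add_mset (Var (left (right t))) (succedent (right t)))) (pair 0 0)
        else infer_code n (left t) (right (right (right t)))
          (lookup t (history (\<lambda>t. ptree_code (nth_proof n t)) t) (left (right t)))
          (lookup t (history (\<lambda>t. ptree_code (nth_proof n t)) t) (left (right (right t)))))" for t
  proof (cases "left t = 0")
    case True
    then show ?thesis by (subst nth_proof.simps) (simp add: axiom_node_def flip: pair_def)
  next
    case False
    then have "right t < t" by (rule right_less)
    then have "left (right t) < t" "left (right (right t)) < t"
      using left_le[of "right t"] right_le[of "right t"] left_le[of "right (right t)"] by auto
    then show ?thesis using False by (subst nth_proof.simps) (simp add: lookup_history infer_code)
  qed
qed (rule computable_id)+

text \<open>The searched relation is decidable, so the unbounded search meets a defined nonzero value at
  each failure and stops at the first witness.\<close>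
lemma computes_search:
  assumes P: "decidable (\<lambda>y. P (left y) (right y))" and g: "computable g"
  shows "\<exists>f. \<forall>x. (\<exists>t. P t x) \<longrightarrow> (\<exists>t. P t x \<and> computes f [x] (g t))"
proof -
  have "computable (\<lambda>y. if P (left y) (right y) then 0 else 1)"
    using P by (intro computable_if computable_const)
  then obtain c where c: "\<And>y. computes c [y] (if P (left y) (right y) then 0 else 1)"
    unfolding computable_def by blast
  obtain pg where pg: "\<And>x. computes pg [x] (g x)" using g unfolding computable_def by blast
  have c': "computes (Comp c [pair_rec]) [t, x] (if P t x then 0 else 1)" for t x
    using computes_Comp1[OF pair_rec c, of t x] by simp
  have "computes (Comp pg [Mu (Comp c [pair_rec])]) [x] (g (LEAST t. P t x))" if "\<exists>t. P t x" for x
  proof (rule computes_Comp1[OF computes.mu pg])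
    show "computes (Comp c [pair_rec]) [LEAST t. P t x, x] 0"
      using c'[of "LEAST t. P t x" x] LeastI_ex[OF that] by simp
    fix t assume "t < (LEAST t. P t x)"
    then have "\<not> P t x" by (rule not_less_Least)
    then show "\<exists>v. computes (Comp c [pair_rec]) [t, x] (Suc v)"
      using c'[of t x] by auto
  qed
  then show ?thesis using LeastI_ex by (metis (no_types, lifting))
qed

section \<open>Effective cut elimination\<close>

theorem mainTheorem1:
  fixes n :: nat
  assumes "n \<ge> 1"
  shows "\<exists>f :: recf. \<forall>P S. proof_of n GwGL_Cut P S \<longrightarrow>
           (\<exists>Q. proof_of n GwGL Q S \<and> computes f [ptree_code P] (ptree_code Q))"
proof -
  have comp: "computable (\<lambda>x. ptree_code (nth_proof n (a x)))" if "computable a" for a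
    using computable_comp[OF computable_nth_proof that] .
  \<comment> \<open>The left component of the code of a proof is the code of its end sequent.\<close>
  have "decidable (\<lambda>y. left (ptree_code (nth_proof n (left y))) = left (right y))"
    by (intro decidable_eq computable_left comp computable_right computable_id)
  from computes_search[where P = "\<lambda>t x. left (ptree_code (nth_proof n t)) = left x", OF this computable_nth_proof]
  obtain f where f: "\<And>x. \<exists>t. left (ptree_code (nth_proof n t)) = left x \<Longrightarrow>
      \<exists>t. left (ptree_code (nth_proof n t)) = left x \<and> computes f [x] (ptree_code (nth_proof n t))"
    by blast
  have "\<exists>Q. proof_of n GwGL Q S \<and> computes f [ptree_code P] (ptree_code Q)"
    if PS: "proof_of n GwGL_Cut P S" for P S
  proof -
    obtain Q where Q: "proof_of n GwGL Q S" using cut_admissible[OF assms PS] by blast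
    then obtain t where "nth_proof n t = Q" using nth_proof_complete unfolding proof_of_def by blast
    then have "left (ptree_code (nth_proof n t)) = left (ptree_code P)"
      using Q PS by (simp add: left_ptree_code proof_of_def)
    then obtain t where t: "left (ptree_code (nth_proof n t)) = left (ptree_code P)"
        "computes f [ptree_code P] (ptree_code (nth_proof n t))"
      using f by blast
    have "root (nth_proof n t) = S"
      using t(1) PS by (simp add: left_ptree_code proof_of_def sequent_code_inject)
    then show ?thesis using t(2) nth_proof_correct unfolding proof_of_def by blast
  qed
  then show ?thesis by blast
qed

end
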